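(* The radical of $\ell^1\big(\bigoplus_{i=1}^\infty\mathbb{Z}\big)''$ (with the first Arens product $\Box$) contains non-nilpotent elements.
   Context: $\mathbb{N}=\{1,2,\ldots\}$. $\bigoplus_{i=1}^\infty\mathbb{Z}=\{(n_i)\in\mathbb{Z}^{\mathbb{N}}: n_i=0\text{ for all but finitely many }i\}$, regarded as a discrete group. For a discrete group $G$, $\ell^1(G)$ is the group algebra of absolutely summable functions $G\to\mathbb{C}$ under convolution. For a Banach algebra $A$ with dual $A'$ and bidual $A''$, the first Arens product $\Box$ on $A''$ is defined by $\langle\Psi\Box\Phi,\lambda\rangle=\langle\Psi,\Phi\cdot\lambda\rangle$, $\langle\Phi\cdot\lambda,a\rangle=\langle\Phi,\lambda\cdot a\rangle$, $\langle\lambda\cdot a,b\rangle=\langle\lambda,ab\rangle$ for $\Phi,\Psi\in A''$, $\lambda\in A'$, $a,b\in A$; it makes $A''$ a Banach algebra extending $A$. The radical of a unital Banach algebra $B$ is the Jacobson radical: $\operatorname{rad}(B)=\{a\in B: ba\text{ is quasi-nilpotent for every }b\in B\}$, where $a$ is quasi-nilpotent if $\lim_n\|a^n\|^{1/n}=0$. An element $a$ is nilpotent if $a^n=0$ for some $n\in\mathbb{N}$. *)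

theory Defs
  imports "HOL-Analysis.Infinite_Sum" "HOL-Analysis.Operator_Norm" "HOL-Library.Poly_Mapping"
begin

section \<open>Complex normed spaces and algebras\<close>

text \<open>The library's normed spaces and algebras have real scalars only; the classes below add a
  compatible multiplication by complex scalars.\<close>

class scaleC =
  fixes scaleC :: "complex \<Rightarrow> 'a \<Rightarrow> 'a" (infixr "*\<^sub>C" 75)

class complex_normed_vector = real_normed_vector + scaleC +
  assumes scaleC_add_right: "c *\<^sub>C (x + y) = c *\<^sub>C x + c *\<^sub>C y"
    and scaleC_add_left: "(c + d) *\<^sub>C x = c *\<^sub>C x + d *\<^sub>C x"
    and scaleC_scaleC: "c *\<^sub>C d *\<^sub>C x = (c * d) *\<^sub>C x"
    and scaleC_of_real: "complex_of_real r *\<^sub>C x = r *\<^sub>R x"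
    and norm_scaleC: "norm (c *\<^sub>C x) = cmod c * norm x"

class complex_normed_algebra = complex_normed_vector + real_normed_algebra +
  assumes mult_scaleC_left: "c *\<^sub>C x * y = c *\<^sub>C (x * y)"
    and mult_scaleC_right: "x * c *\<^sub>C y = c *\<^sub>C (x * y)"

section \<open>The dual space\<close>

definition bounded_clinear :: "('a::complex_normed_vector \<Rightarrow> complex) \<Rightarrow> bool" where
  "bounded_clinear f \<longleftrightarrow> bounded_linear f \<and> (\<forall>c x. f (c *\<^sub>C x) = c * f x)"

lemma bounded_clinear_imp_bounded_linear: "bounded_clinear f \<Longrightarrow> bounded_linear f"
  by (simp add: bounded_clinear_def)

typedef (overloaded) ('a::complex_normed_vector) cdual =
  "{f :: 'a \<Rightarrow> complex. bounded_clinear f}"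
  morphisms cdual_apply Abs_cdual
  by (rule exI[of _ "\<lambda>_. 0"]) (simp add: bounded_clinear_def)

setup_lifting type_definition_cdual

instantiation cdual :: (complex_normed_vector) complex_normed_vector
begin

lift_definition zero_cdual :: "'a cdual" is "\<lambda>_. 0"
  by (simp add: bounded_clinear_def)

lift_definition plus_cdual :: "'a cdual \<Rightarrow> 'a cdual \<Rightarrow> 'a cdual" is "\<lambda>f g x. f x + g x"
  by (simp add: bounded_clinear_def bounded_linear_add algebra_simps)

lift_definition minus_cdual :: "'a cdual \<Rightarrow> 'a cdual \<Rightarrow> 'a cdual" is "\<lambda>f g x. f x - g x"
  by (simp add: bounded_clinear_def bounded_linear_sub algebra_simps)

lift_definition uminus_cdual :: "'a cdual \<Rightarrow> 'a cdual" is "\<lambda>f x. - f x"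
  by (simp add: bounded_clinear_def bounded_linear_minus)

lift_definition scaleR_cdual :: "real \<Rightarrow> 'a cdual \<Rightarrow> 'a cdual" is "\<lambda>r f x. r *\<^sub>R f x"
  by (auto simp: bounded_clinear_def intro: bounded_linear_compose[OF bounded_linear_scaleR_right])

lift_definition scaleC_cdual :: "complex \<Rightarrow> 'a cdual \<Rightarrow> 'a cdual" is "\<lambda>c f x. c * f x"
  by (auto simp: bounded_clinear_def intro: bounded_linear_compose[OF bounded_linear_mult_right])

lift_definition norm_cdual :: "'a cdual \<Rightarrow> real" is onorm .

definition dist_cdual :: "'a cdual \<Rightarrow> 'a cdual \<Rightarrow> real" where
  "dist_cdual f g = norm (f - g)"

definition sgn_cdual :: "'a cdual \<Rightarrow> 'a cdual" where
  "sgn_cdual f = inverse (norm f) *\<^sub>R f"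

definition
  "(uniformity :: ('a cdual \<times> 'a cdual) filter) =
    (INF e\<in>{0 <..}. principal {(x, y). dist x y < e})"

definition open_cdual :: "'a cdual set \<Rightarrow> bool" where
  "open_cdual S = (\<forall>x\<in>S. \<forall>\<^sub>F (x', y) in uniformity. x' = x \<longrightarrow> y \<in> S)"

instance
proof
  fix f g h :: "'a cdual" and r s :: real and c d :: complex
  show "f + g + h = f + (g + h)" "f + g = g + f" "0 + f = f" "- f + f = 0" "f - g = f + - g"
    by (transfer, simp add: fun_eq_iff add.assoc add.commute)+
  show "r *\<^sub>R (f + g) = r *\<^sub>R f + r *\<^sub>R g" "(r + s) *\<^sub>R f = r *\<^sub>R f + s *\<^sub>R f"
    "r *\<^sub>R s *\<^sub>R f = (r * s) *\<^sub>R f" "1 *\<^sub>R f = f"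
    by (transfer, simp add: fun_eq_iff scaleR_add_right scaleR_add_left)+
  show "c *\<^sub>C (f + g) = c *\<^sub>C f + c *\<^sub>C g" "(c + d) *\<^sub>C f = c *\<^sub>C f + d *\<^sub>C f"
    "c *\<^sub>C d *\<^sub>C f = (c * d) *\<^sub>C f" "complex_of_real r *\<^sub>C f = r *\<^sub>R f"
    by (transfer, simp add: fun_eq_iff distrib_left distrib_right scaleR_conv_of_real)+
  show "norm f = 0 \<longleftrightarrow> f = 0"
    by transfer (simp add: onorm_eq_0 bounded_clinear_imp_bounded_linear fun_eq_iff)
  show "norm (f + g) \<le> norm f + norm g"
    by transfer (simp add: onorm_triangle bounded_clinear_imp_bounded_linear)
  show "norm (r *\<^sub>R f) = \<bar>r\<bar> * norm f"
    by transfer (simp add: onorm_scaleR bounded_clinear_imp_bounded_linear)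
  show "norm (c *\<^sub>C f) = cmod c * norm f"
  proof transfer
    fix c :: complex and f :: "'a \<Rightarrow> complex"
    assume "bounded_clinear f"
    then have f: "bounded_linear f" by (rule bounded_clinear_imp_bounded_linear)
    have cf: "bounded_linear (\<lambda>x. c * f x)"
      using f by (intro bounded_linear_compose[OF bounded_linear_mult_right])
    show "onorm (\<lambda>x. c * f x) = cmod c * onorm f"
    proof (cases "c = 0")
      case False
      have "onorm (\<lambda>x. c * f x) \<le> cmod c * onorm f"
      proof (rule onorm_bound)
        show "norm (c * f x) \<le> cmod c * onorm f * norm x" for x
          using onorm[OF f, of x] by (simp add: norm_mult mult.assoc mult_left_mono)
      qed (simp add: onorm_pos_le[OF f])
      moreover have "onorm f \<le> onorm (\<lambda>x. c * f x) / cmod c"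
      proof (rule onorm_bound)
        show "norm (f x) \<le> onorm (\<lambda>x. c * f x) / cmod c * norm x" for x
          using onorm[OF cf, of x] False by (simp add: norm_mult field_simps)
      qed (simp add: onorm_pos_le[OF cf])
      ultimately show ?thesis
        using False by (simp add: field_simps)
    qed (simp add: onorm_zero)
  qed
qed (simp_all only: dist_cdual_def open_cdual_def sgn_cdual_def uniformity_cdual_def)

end

lemma cdual_eqI: "(\<And>x. cdual_apply f x = cdual_apply g x) \<Longrightarrow> f = g"
  by transfer auto

lemma bounded_clinear_cdual_apply: "bounded_clinear (cdual_apply f)"
  using cdual_apply by simp

lemma
  shows cdual_apply_zero_right: "cdual_apply f 0 = 0"
    and cdual_apply_add_right: "cdual_apply f (x + y) = cdual_apply f x + cdual_apply f y"
    and cdual_apply_scaleR_right: "cdual_apply f (r *\<^sub>R x) = r *\<^sub>R cdual_apply f x"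
    and cdual_apply_scaleC_right: "cdual_apply f (c *\<^sub>C x) = c * cdual_apply f x"
  using bounded_clinear_cdual_apply[of f]
  by (auto simp: bounded_clinear_def linear_0 linear_add linear_scale dest!: bounded_linear.linear)

lemma norm_cdual_apply_le: "norm (cdual_apply f x) \<le> norm f * norm x"
  by transfer (simp add: onorm bounded_clinear_imp_bounded_linear)

lemma norm_cdual_bound:
  "0 \<le> b \<Longrightarrow> (\<And>x. norm (cdual_apply f x) \<le> b * norm x) \<Longrightarrow> norm f \<le> b"
  by transfer (rule onorm_bound)

lemma bounded_clinearI:
  assumes "\<And>x y. f (x + y) = f x + f y"
    and "\<And>c x. f (c *\<^sub>C x) = c * f x"
    and "\<And>x. norm (f x) \<le> norm x * K"
  shows "bounded_clinear f"
proof -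
  have "f (r *\<^sub>R x) = r *\<^sub>R f x" for r x
    using assms(2)[of "of_real r" x] by (simp add: scaleC_of_real scaleR_conv_of_real)
  then show ?thesis
    using assms by (auto simp: bounded_clinear_def intro!: bounded_linear_intro[of _ K])
qed

instance cdual :: (complex_normed_vector) banach
proof
  fix X :: "nat \<Rightarrow> 'a cdual"
  assume X: "Cauchy X"
  have "convergent (\<lambda>n. cdual_apply (X n) x)" for x
  proof (rule Cauchy_convergent, rule CauchyI)
    fix e :: real
    assume "e > 0"
    then have "e / (norm x + 1) > 0" by (simp add: add_nonneg_pos)
    then obtain M where M: "\<And>m n. m \<ge> M \<Longrightarrow> n \<ge> M \<Longrightarrow> norm (X m - X n) < e / (norm x + 1)"
      using CauchyD[OF X] by blast
    have "norm (cdual_apply (X m) x - cdual_apply (X n) x) < e" if "m \<ge> M" "n \<ge> M" for m n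
    proof -
      have "norm (cdual_apply (X m) x - cdual_apply (X n) x) \<le> norm (X m - X n) * norm x"
        using norm_cdual_apply_le[of "X m - X n" x] by (simp add: minus_cdual.rep_eq)
      also have "\<dots> \<le> norm (X m - X n) * (norm x + 1)"
        by (intro mult_left_mono) auto
      also have "\<dots> < e"
        using M[OF that] by (simp add: pos_less_divide_eq add_nonneg_pos)
      finally show ?thesis .
    qed
    then show "\<exists>M. \<forall>m\<ge>M. \<forall>n\<ge>M. norm (cdual_apply (X m) x - cdual_apply (X n) x) < e"
      by blast
  qed
  then obtain L where L: "\<And>x. (\<lambda>n. cdual_apply (X n) x) \<longlonglongrightarrow> L x"
    unfolding convergent_def by metis
  have bound: "\<exists>M. \<forall>n\<ge>M. \<forall>x. norm (cdual_apply (X n) x - L x) \<le> e * norm x" if e: "e > 0" for e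
  proof -
    obtain M where M: "\<And>m n. m \<ge> M \<Longrightarrow> n \<ge> M \<Longrightarrow> norm (X m - X n) < e"
      using CauchyD[OF X e] by blast
    have "norm (cdual_apply (X n) x - L x) \<le> e * norm x" if "n \<ge> M" for n x
    proof (rule LIMSEQ_le_const2)
      show "(\<lambda>m. norm (cdual_apply (X n) x - cdual_apply (X m) x)) \<longlonglongrightarrow>
          norm (cdual_apply (X n) x - L x)"
        by (intro tendsto_intros L)
      have "norm (cdual_apply (X n) x - cdual_apply (X m) x) \<le> e * norm x" if "m \<ge> M" for m
      proof -
        have "norm (cdual_apply (X n) x - cdual_apply (X m) x) \<le> norm (X n - X m) * norm x"
          using norm_cdual_apply_le[of "X n - X m" x] by (simp add: minus_cdual.rep_eq)
        also have "\<dots> \<le> e * norm x"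
          using M[OF \<open>n \<ge> M\<close> that] by (intro mult_right_mono) auto
        finally show ?thesis .
      qed
      then show "\<exists>N. \<forall>m\<ge>N. norm (cdual_apply (X n) x - cdual_apply (X m) x) \<le> e * norm x"
        by blast
    qed
    then show ?thesis by blast
  qed
  have "bounded_clinear L"
  proof -
    obtain n where n: "\<And>x. norm (cdual_apply (X n) x - L x) \<le> 1 * norm x"
      using bound[of 1] by auto
    show ?thesis
    proof (rule bounded_clinearI)
      show "L (x + y) = L x + L y" for x y
        using L[of "x + y"] tendsto_add[OF L[of x] L[of y]]
        by (simp add: cdual_apply_add_right LIMSEQ_unique)
      show "L (c *\<^sub>C x) = c * L x" for c x
        using L[of "c *\<^sub>C x"] tendsto_mult_left[OF L[of x], of c]
        by (simp add: cdual_apply_scaleC_right LIMSEQ_unique)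
      show "norm (L x) \<le> norm x * (norm (X n) + 1)" for x
        using n[of x] norm_cdual_apply_le[of "X n" x]
          norm_triangle_ineq3[of "L x" "cdual_apply (X n) x"]
        by (simp add: algebra_simps norm_minus_commute)
    qed
  qed
  then have Lx: "cdual_apply (Abs_cdual L) = L"
    by (simp add: Abs_cdual_inverse)
  have "X \<longlonglongrightarrow> Abs_cdual L"
  proof (rule LIMSEQ_I)
    fix e :: real
    assume "e > 0"
    then obtain M where "\<And>n x. n \<ge> M \<Longrightarrow> norm (cdual_apply (X n) x - L x) \<le> e / 2 * norm x"
      using bound[of "e / 2"] by auto
    then have "norm (X n - Abs_cdual L) \<le> e / 2" if "n \<ge> M" for n
      using that \<open>e > 0\<close> by (intro norm_cdual_bound) (auto simp: minus_cdual.rep_eq Lx)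
    then show "\<exists>M. \<forall>n\<ge>M. norm (X n - Abs_cdual L) < e"
      using \<open>e > 0\<close> by (intro exI[of _ M]) fastforce
  qed
  then show "convergent X"
    by (rule convergentI)
qed

section \<open>The bidual and the first Arens product\<close>

text \<open>The two module actions \<open>\<lambda> \<cdot> a\<close> and \<open>\<Phi> \<cdot> \<lambda>\<close>, both with values in the dual space.\<close>

lift_definition dual_act :: "('a::complex_normed_algebra) cdual \<Rightarrow> 'a \<Rightarrow> 'a cdual" is
  "\<lambda>l a b. l (a * b)"
proof -
  fix l :: "'a \<Rightarrow> complex" and a :: 'a
  assume "bounded_clinear l"
  then show "bounded_clinear (\<lambda>b. l (a * b))"
    by (auto simp: bounded_clinear_def mult_scaleC_right
        intro: bounded_linear_compose[OF _ bounded_linear_mult_right])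
qed

lemma norm_dual_act_le: "norm (dual_act l a) \<le> norm l * norm a"
proof (rule norm_cdual_bound)
  fix b
  have "norm (cdual_apply (dual_act l a) b) \<le> norm l * norm (a * b)"
    by (simp add: dual_act.rep_eq norm_cdual_apply_le)
  also have "\<dots> \<le> norm l * (norm a * norm b)"
    by (intro mult_left_mono norm_mult_ineq norm_ge_zero)
  finally show "norm (cdual_apply (dual_act l a) b) \<le> norm l * norm a * norm b"
    by (simp add: mult.assoc)
qed simp

lemma
  shows dual_act_add_left: "dual_act (l + m) a = dual_act l a + dual_act m a"
    and dual_act_add_right: "dual_act l (a + b) = dual_act l a + dual_act l b"
    and dual_act_scaleC_left: "dual_act (c *\<^sub>C l) a = c *\<^sub>C dual_act l a"
    and dual_act_scaleC_right: "dual_act l (c *\<^sub>C a) = c *\<^sub>C dual_act l a"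
    and dual_act_dual_act: "dual_act (dual_act l a) b = dual_act l (a * b)"
  by (auto intro!: cdual_eqI simp: dual_act.rep_eq plus_cdual.rep_eq scaleC_cdual.rep_eq
      cdual_apply_add_right cdual_apply_scaleC_right distrib_right mult_scaleC_left mult.assoc)

lift_definition bidual_act ::
  "('a::complex_normed_algebra) cdual cdual \<Rightarrow> 'a cdual \<Rightarrow> 'a cdual" is
  "\<lambda>\<Phi> l a. cdual_apply \<Phi> (dual_act l a)"
proof (rule bounded_clinearI)
  fix \<Phi> :: "'a cdual cdual" and l :: "'a cdual" and a :: 'a
  have "norm (cdual_apply \<Phi> (dual_act l a)) \<le> norm \<Phi> * norm (dual_act l a)"
    by (rule norm_cdual_apply_le)
  also have "\<dots> \<le> norm \<Phi> * (norm l * norm a)"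
    by (intro mult_left_mono norm_dual_act_le norm_ge_zero)
  finally show "norm (cdual_apply \<Phi> (dual_act l a)) \<le> norm a * (norm \<Phi> * norm l)"
    by (simp add: mult_ac)
qed (simp_all add: dual_act_add_right dual_act_scaleC_right cdual_apply_add_right
    cdual_apply_scaleC_right)

lemma norm_bidual_act_le: "norm (bidual_act \<Phi> l) \<le> norm \<Phi> * norm l"
proof (rule norm_cdual_bound)
  fix a
  have "norm (cdual_apply (bidual_act \<Phi> l) a) \<le> norm \<Phi> * norm (dual_act l a)"
    by (simp add: bidual_act.rep_eq norm_cdual_apply_le)
  also have "\<dots> \<le> norm \<Phi> * (norm l * norm a)"
    by (intro mult_left_mono norm_dual_act_le norm_ge_zero)
  finally show "norm (cdual_apply (bidual_act \<Phi> l) a) \<le> norm \<Phi> * norm l * norm a"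
    by (simp add: mult.assoc)
qed simp

lemma
  shows bidual_act_add_left: "bidual_act (\<Phi> + \<Psi>) l = bidual_act \<Phi> l + bidual_act \<Psi> l"
    and bidual_act_add_right: "bidual_act \<Phi> (l + m) = bidual_act \<Phi> l + bidual_act \<Phi> m"
    and bidual_act_scaleC_left: "bidual_act (c *\<^sub>C \<Phi>) l = c *\<^sub>C bidual_act \<Phi> l"
    and bidual_act_scaleC_right: "bidual_act \<Phi> (c *\<^sub>C l) = c *\<^sub>C bidual_act \<Phi> l"
    and dual_act_bidual_act: "dual_act (bidual_act \<Phi> l) a = bidual_act \<Phi> (dual_act l a)"
  by (auto intro!: cdual_eqI simp: dual_act.rep_eq bidual_act.rep_eq plus_cdual.rep_eq
      scaleC_cdual.rep_eq cdual_apply_add_right cdual_apply_scaleC_right dual_act_add_left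
      dual_act_scaleC_left dual_act_dual_act)

lift_definition arens ::
  "('a::complex_normed_algebra) cdual cdual \<Rightarrow> 'a cdual cdual \<Rightarrow> 'a cdual cdual" is
  "\<lambda>\<Psi> \<Phi> l. cdual_apply \<Psi> (bidual_act \<Phi> l)"
proof (rule bounded_clinearI)
  fix \<Psi> \<Phi> :: "'a cdual cdual" and l :: "'a cdual"
  have "norm (cdual_apply \<Psi> (bidual_act \<Phi> l)) \<le> norm \<Psi> * norm (bidual_act \<Phi> l)"
    by (rule norm_cdual_apply_le)
  also have "\<dots> \<le> norm \<Psi> * (norm \<Phi> * norm l)"
    by (intro mult_left_mono norm_bidual_act_le norm_ge_zero)
  finally show "norm (cdual_apply \<Psi> (bidual_act \<Phi> l)) \<le> norm l * (norm \<Psi> * norm \<Phi>)"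
    by (simp add: mult_ac)
qed (simp_all add: bidual_act_add_right bidual_act_scaleC_right cdual_apply_add_right
    cdual_apply_scaleC_right)

lemma norm_arens_le: "norm (arens \<Psi> \<Phi>) \<le> norm \<Psi> * norm \<Phi>"
proof (rule norm_cdual_bound)
  fix l
  have "norm (cdual_apply (arens \<Psi> \<Phi>) l) \<le> norm \<Psi> * norm (bidual_act \<Phi> l)"
    by (simp add: arens.rep_eq norm_cdual_apply_le)
  also have "\<dots> \<le> norm \<Psi> * (norm \<Phi> * norm l)"
    by (intro mult_left_mono norm_bidual_act_le norm_ge_zero)
  finally show "norm (cdual_apply (arens \<Psi> \<Phi>) l) \<le> norm \<Psi> * norm \<Phi> * norm l"
    by (simp add: mult.assoc)
qed simp

lemma
  shows arens_add_left: "arens (\<Psi> + \<Psi>') \<Phi> = arens \<Psi> \<Phi> + arens \<Psi>' \<Phi>"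
    and arens_add_right: "arens \<Psi> (\<Phi> + \<Phi>') = arens \<Psi> \<Phi> + arens \<Psi> \<Phi>'"
    and arens_scaleC_left: "arens (c *\<^sub>C \<Psi>) \<Phi> = c *\<^sub>C arens \<Psi> \<Phi>"
    and arens_scaleC_right: "arens \<Psi> (c *\<^sub>C \<Phi>) = c *\<^sub>C arens \<Psi> \<Phi>"
  by (auto intro!: cdual_eqI simp: arens.rep_eq plus_cdual.rep_eq scaleC_cdual.rep_eq
      bidual_act_add_left bidual_act_scaleC_left cdual_apply_add_right cdual_apply_scaleC_right)

lemma bidual_act_arens: "bidual_act (arens \<Psi> \<Phi>) l = bidual_act \<Psi> (bidual_act \<Phi> l)"
  by (rule cdual_eqI) (simp add: bidual_act.rep_eq arens.rep_eq dual_act_bidual_act)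

lemma arens_assoc: "arens (arens X \<Psi>) \<Phi> = arens X (arens \<Psi> \<Phi>)"
  by (rule cdual_eqI) (simp add: arens.rep_eq bidual_act_arens)

lift_definition canonical_embedding :: "'a::complex_normed_vector \<Rightarrow> 'a cdual cdual" is
  "\<lambda>a l. cdual_apply l a"
proof (rule bounded_clinearI)
  show "norm (cdual_apply l a) \<le> norm l * norm a" for l :: "'a cdual" and a
    by (rule norm_cdual_apply_le)
qed (simp_all add: plus_cdual.rep_eq scaleC_cdual.rep_eq)

lemma canonical_embedding_mult:
  "canonical_embedding (a * b) = arens (canonical_embedding a) (canonical_embedding b)"
  by (rule cdual_eqI)
    (simp add: canonical_embedding.rep_eq arens.rep_eq bidual_act.rep_eq dual_act.rep_eq)

text \<open>The second dual space gets a type of its own so that the first Arens product can be its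
  multiplication in the sense of the type classes. All vector space structure and the norm are
  those of \<open>'a cdual cdual\<close>.\<close>

typedef (overloaded) ('a::complex_normed_vector) bidual = "UNIV :: 'a cdual cdual set"
  morphisms of_bidual Bidual
  by simp

setup_lifting type_definition_bidual

instantiation bidual :: (complex_normed_vector) complex_normed_vector
begin

lift_definition zero_bidual :: "'a bidual" is 0 .
lift_definition plus_bidual :: "'a bidual \<Rightarrow> 'a bidual \<Rightarrow> 'a bidual" is plus .
lift_definition minus_bidual :: "'a bidual \<Rightarrow> 'a bidual \<Rightarrow> 'a bidual" is minus .
lift_definition uminus_bidual :: "'a bidual \<Rightarrow> 'a bidual" is uminus .
lift_definition scaleR_bidual :: "real \<Rightarrow> 'a bidual \<Rightarrow> 'a bidual" is scaleR .
lift_definition scaleC_bidual :: "complex \<Rightarrow> 'a bidual \<Rightarrow> 'a bidual" is scaleC .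
lift_definition norm_bidual :: "'a bidual \<Rightarrow> real" is norm .

definition dist_bidual :: "'a bidual \<Rightarrow> 'a bidual \<Rightarrow> real" where
  "dist_bidual x y = norm (x - y)"

definition sgn_bidual :: "'a bidual \<Rightarrow> 'a bidual" where
  "sgn_bidual x = inverse (norm x) *\<^sub>R x"

definition
  "(uniformity :: ('a bidual \<times> 'a bidual) filter) =
    (INF e\<in>{0 <..}. principal {(x, y). dist x y < e})"

definition open_bidual :: "'a bidual set \<Rightarrow> bool" where
  "open_bidual S = (\<forall>x\<in>S. \<forall>\<^sub>F (x', y) in uniformity. x' = x \<longrightarrow> y \<in> S)"

instance
  by standard
    (unfold dist_bidual_def open_bidual_def sgn_bidual_def uniformity_bidual_def,
     (rule refl | (transfer, simp add: norm_triangle_ineq scaleC_add_right scaleC_add_left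
        scaleC_scaleC scaleC_of_real norm_scaleC algebra_simps))+)

end

instance bidual :: (complex_normed_vector) banach
proof
  fix X :: "nat \<Rightarrow> 'a bidual"
  assume "Cauchy X"
  then have "Cauchy (\<lambda>n. of_bidual (X n))"
    by (simp add: Cauchy_iff norm_bidual.rep_eq minus_bidual.rep_eq)
  then obtain L where "(\<lambda>n. of_bidual (X n)) \<longlonglongrightarrow> L"
    using Cauchy_convergent convergentD by blast
  then have "X \<longlonglongrightarrow> Bidual L"
    by (simp add: LIMSEQ_iff norm_bidual.rep_eq minus_bidual.rep_eq Bidual_inverse)
  then show "convergent X"
    by (rule convergentI)
qed

instantiation bidual :: (complex_normed_algebra) complex_normed_algebra
begin

lift_definition times_bidual :: "'a bidual \<Rightarrow> 'a bidual \<Rightarrow> 'a bidual" is arens .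

instance
proof
  fix x y z :: "'a bidual" and r :: real and c :: complex
  show "x * y * z = x * (y * z)" by transfer (rule arens_assoc)
  show "(x + y) * z = x * z + y * z" by transfer (rule arens_add_left)
  show "x * (y + z) = x * y + x * z" by transfer (rule arens_add_right)
  show *: "c *\<^sub>C x * y = c *\<^sub>C (x * y)" for c by transfer (rule arens_scaleC_left)
  show **: "x * c *\<^sub>C y = c *\<^sub>C (x * y)" for c by transfer (rule arens_scaleC_right)
  show "r *\<^sub>R x * y = r *\<^sub>R (x * y)" using *[of "of_real r"] by (simp add: scaleC_of_real)
  show "x * r *\<^sub>R y = r *\<^sub>R (x * y)" using **[of "of_real r"] by (simp add: scaleC_of_real)
  show "norm (x * y) \<le> norm x * norm y" by transfer (rule norm_arens_le)
qed

end

instantiation bidual :: ("{complex_normed_algebra, monoid_mult}") monoid_mult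
begin

lift_definition one_bidual :: "'a bidual" is "canonical_embedding 1" .

instance
proof
  fix x :: "'a bidual"
  show "1 * x = x"
    by transfer (auto intro!: cdual_eqI arg_cong[of _ _ "cdual_apply _"]
        simp: arens.rep_eq canonical_embedding.rep_eq bidual_act.rep_eq dual_act.rep_eq)
  show "x * 1 = x"
    by transfer (auto intro!: cdual_eqI arg_cong[of _ _ "cdual_apply _"]
        simp: arens.rep_eq canonical_embedding.rep_eq bidual_act.rep_eq dual_act.rep_eq)
qed

end

section \<open>The group algebra of a discrete group\<close>

text \<open>The class \<^class>\<open>group_add\<close> is that of arbitrary, not necessarily commutative,
  groups in additive notation.\<close>

typedef 'g ell1 = "{f :: 'g \<Rightarrow> complex. f abs_summable_on UNIV}"
  morphisms ell1_apply Abs_ell1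
  by (rule exI[of _ "\<lambda>_. 0"]) simp

setup_lifting type_definition_ell1

lemma ell1_eqI: "(\<And>x. ell1_apply f x = ell1_apply g x) \<Longrightarrow> f = g"
  by transfer auto

lemma abs_summable_add:
  fixes f g :: "'g \<Rightarrow> complex"
  assumes "f abs_summable_on A" "g abs_summable_on A"
  shows "(\<lambda>x. f x + g x) abs_summable_on A"
  by (rule abs_summable_on_comparison_test'[OF summable_on_add[OF assms]])
    (rule norm_triangle_ineq)

lemma abs_summable_cmult:
  fixes f :: "'g \<Rightarrow> complex"
  assumes "f abs_summable_on A"
  shows "(\<lambda>x. c * f x) abs_summable_on A"
  using summable_on_cmult_right[OF assms, of "cmod c"] by (simp add: norm_mult)

instantiation ell1 :: (type) complex_normed_vector
begin

lift_definition zero_ell1 :: "'a ell1" is "\<lambda>_. 0" by simp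

lift_definition plus_ell1 :: "'a ell1 \<Rightarrow> 'a ell1 \<Rightarrow> 'a ell1" is "\<lambda>f g x. f x + g x"
  by (rule abs_summable_add)

lift_definition minus_ell1 :: "'a ell1 \<Rightarrow> 'a ell1 \<Rightarrow> 'a ell1" is "\<lambda>f g x. f x - g x"
  using abs_summable_add[OF _ abs_summable_cmult[of _ _ "-1"]] by fastforce

lift_definition uminus_ell1 :: "'a ell1 \<Rightarrow> 'a ell1" is "\<lambda>f x. - f x" by simp

lift_definition scaleR_ell1 :: "real \<Rightarrow> 'a ell1 \<Rightarrow> 'a ell1" is "\<lambda>r f x. r *\<^sub>R f x"
  using abs_summable_cmult by (simp add: scaleR_conv_of_real)

lift_definition scaleC_ell1 :: "complex \<Rightarrow> 'a ell1 \<Rightarrow> 'a ell1" is "\<lambda>c f x. c * f x"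
  by (rule abs_summable_cmult)

lift_definition norm_ell1 :: "'a ell1 \<Rightarrow> real" is "\<lambda>f. \<Sum>\<^sub>\<infinity>x. cmod (f x)" .

definition dist_ell1 :: "'a ell1 \<Rightarrow> 'a ell1 \<Rightarrow> real" where
  "dist_ell1 f g = norm (f - g)"

definition sgn_ell1 :: "'a ell1 \<Rightarrow> 'a ell1" where
  "sgn_ell1 f = inverse (norm f) *\<^sub>R f"

definition
  "(uniformity :: ('a ell1 \<times> 'a ell1) filter) =
    (INF e\<in>{0 <..}. principal {(x, y). dist x y < e})"

definition open_ell1 :: "'a ell1 set \<Rightarrow> bool" where
  "open_ell1 S = (\<forall>x\<in>S. \<forall>\<^sub>F (x', y) in uniformity. x' = x \<longrightarrow> y \<in> S)"

instance
proof
  fix f g h :: "'a ell1" and r s :: real and c d :: complex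
  show "f + g + h = f + (g + h)" "f + g = g + f" "0 + f = f" "- f + f = 0" "f - g = f + - g"
    by (transfer, simp add: fun_eq_iff add.assoc add.commute)+
  show "r *\<^sub>R (f + g) = r *\<^sub>R f + r *\<^sub>R g" "(r + s) *\<^sub>R f = r *\<^sub>R f + s *\<^sub>R f"
    "r *\<^sub>R s *\<^sub>R f = (r * s) *\<^sub>R f" "1 *\<^sub>R f = f"
    by (transfer, simp add: fun_eq_iff scaleR_add_right scaleR_add_left)+
  show "c *\<^sub>C (f + g) = c *\<^sub>C f + c *\<^sub>C g" "(c + d) *\<^sub>C f = c *\<^sub>C f + d *\<^sub>C f"
    "c *\<^sub>C d *\<^sub>C f = (c * d) *\<^sub>C f" "complex_of_real r *\<^sub>C f = r *\<^sub>R f"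
    by (transfer, simp add: fun_eq_iff distrib_left distrib_right scaleR_conv_of_real)+
  show "norm f = 0 \<longleftrightarrow> f = 0"
  proof transfer
    fix f :: "'a \<Rightarrow> complex"
    assume f: "f abs_summable_on UNIV"
    show "(\<Sum>\<^sub>\<infinity>x. cmod (f x)) = 0 \<longleftrightarrow> f = (\<lambda>_. 0)"
      using nonneg_infsum_le_0D[OF _ f] by (auto simp: fun_eq_iff)
  qed
  show "norm (f + g) \<le> norm f + norm g"
  proof transfer
    fix f g :: "'a \<Rightarrow> complex"
    assume f: "f abs_summable_on UNIV" and g: "g abs_summable_on UNIV"
    have "(\<Sum>\<^sub>\<infinity>x. cmod (f x + g x)) \<le> (\<Sum>\<^sub>\<infinity>x. cmod (f x) + cmod (g x))"
      by (intro infsum_mono abs_summable_add summable_on_add f g norm_triangle_ineq)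
    also have "\<dots> = (\<Sum>\<^sub>\<infinity>x. cmod (f x)) + (\<Sum>\<^sub>\<infinity>x. cmod (g x))"
      by (rule infsum_add[OF f g])
    finally show "(\<Sum>\<^sub>\<infinity>x. cmod (f x + g x)) \<le> (\<Sum>\<^sub>\<infinity>x. cmod (f x)) + (\<Sum>\<^sub>\<infinity>x. cmod (g x))" .
  qed
  show "norm (r *\<^sub>R f) = \<bar>r\<bar> * norm f"
    by transfer (simp add: infsum_cmult_right')
  show "norm (c *\<^sub>C f) = cmod c * norm f"
    by transfer (simp add: norm_mult infsum_cmult_right')
qed (simp_all only: dist_ell1_def open_ell1_def sgn_ell1_def uniformity_ell1_def)

end

instance ell1 :: (type) banach
proof
  fix X :: "nat \<Rightarrow> 'a ell1"
  assume X: "Cauchy X"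
  have sum_le: "(\<Sum>x\<in>F. cmod (ell1_apply f x)) \<le> norm f" if "finite F" for f :: "'a ell1" and F
    using that by transfer (rule finite_sum_le_infsum, auto)
  have apply_le: "cmod (ell1_apply f x) \<le> norm f" for f :: "'a ell1" and x
    using sum_le[of "{x}" f] by simp
  have "convergent (\<lambda>n. ell1_apply (X n) x)" for x
  proof (rule Cauchy_convergent, rule CauchyI)
    fix e :: real
    assume "e > 0"
    then obtain M where M: "\<And>m n. m \<ge> M \<Longrightarrow> n \<ge> M \<Longrightarrow> norm (X m - X n) < e"
      using CauchyD[OF X] by blast
    have "norm (ell1_apply (X m) x - ell1_apply (X n) x) < e" if "m \<ge> M" "n \<ge> M" for m n
      using M[OF that] apply_le[of "X m - X n" x] by (simp add: minus_ell1.rep_eq)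
    then show "\<exists>M. \<forall>m\<ge>M. \<forall>n\<ge>M. norm (ell1_apply (X m) x - ell1_apply (X n) x) < e"
      by blast
  qed
  then obtain L where L: "\<And>x. (\<lambda>n. ell1_apply (X n) x) \<longlonglongrightarrow> L x"
    unfolding convergent_def by metis
  have bound: "\<exists>M. \<forall>n\<ge>M. \<forall>F. finite F \<longrightarrow> (\<Sum>x\<in>F. cmod (ell1_apply (X n) x - L x)) \<le> e"
    if e: "e > 0" for e
  proof -
    obtain M where M: "\<And>m n. m \<ge> M \<Longrightarrow> n \<ge> M \<Longrightarrow> norm (X m - X n) < e"
      using CauchyD[OF X e] by blast
    have "(\<Sum>x\<in>F. cmod (ell1_apply (X n) x - L x)) \<le> e" if "n \<ge> M" "finite F" for n F
    proof (rule LIMSEQ_le_const2)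
      show "(\<lambda>m. \<Sum>x\<in>F. cmod (ell1_apply (X n) x - ell1_apply (X m) x)) \<longlonglongrightarrow>
          (\<Sum>x\<in>F. cmod (ell1_apply (X n) x - L x))"
        by (intro tendsto_intros L)
      have "(\<Sum>x\<in>F. cmod (ell1_apply (X n) x - ell1_apply (X m) x)) \<le> e" if "m \<ge> M" for m
        using sum_le[OF \<open>finite F\<close>, of "X n - X m"] M[OF \<open>n \<ge> M\<close> that]
        by (simp add: minus_ell1.rep_eq)
      then show "\<exists>N. \<forall>m\<ge>N. (\<Sum>x\<in>F. cmod (ell1_apply (X n) x - ell1_apply (X m) x)) \<le> e"
        by blast
    qed
    then show ?thesis by blast
  qed
  have diff: "(\<lambda>x. ell1_apply (X n) x - L x) abs_summable_on UNIV"
    if "\<And>F. finite F \<Longrightarrow> (\<Sum>x\<in>F. cmod (ell1_apply (X n) x - L x)) \<le> e" for n e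
    using that by (intro nonneg_bdd_above_summable_on bdd_aboveI2[where M = e]) auto
  have "L abs_summable_on UNIV"
  proof -
    obtain n where "\<And>F. finite F \<Longrightarrow> (\<Sum>x\<in>F. cmod (ell1_apply (X n) x - L x)) \<le> 1"
      using bound[of 1] by auto
    from diff[OF this] have "(\<lambda>x. - 1 * (ell1_apply (X n) x - L x)) abs_summable_on UNIV"
      by (rule abs_summable_cmult)
    moreover have "ell1_apply (X n) abs_summable_on UNIV"
      using ell1_apply by blast
    ultimately have "(\<lambda>x. ell1_apply (X n) x + - 1 * (ell1_apply (X n) x - L x)) abs_summable_on UNIV"
      by (intro abs_summable_add)
    then show ?thesis by simp
  qed
  then have Lx: "ell1_apply (Abs_ell1 L) = L"
    by (simp add: Abs_ell1_inverse)
  have "X \<longlonglongrightarrow> Abs_ell1 L"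
  proof (rule LIMSEQ_I)
    fix e :: real
    assume "e > 0"
    then obtain M where
      M: "\<And>n F. n \<ge> M \<Longrightarrow> finite F \<Longrightarrow> (\<Sum>x\<in>F. cmod (ell1_apply (X n) x - L x)) \<le> e / 2"
      using bound[of "e / 2"] by auto
    have "norm (X n - Abs_ell1 L) \<le> e / 2" if "n \<ge> M" for n
      unfolding norm_ell1.rep_eq minus_ell1.rep_eq Lx
      by (rule infsum_le_finite_sums[OF diff[OF M[OF that]]]) (use M[OF that] in auto)
    then show "\<exists>M. \<forall>n\<ge>M. norm (X n - Abs_ell1 L) < e"
      using \<open>e > 0\<close> by (intro exI[of _ M]) fastforce
  qed
  then show "convergent X"
    by (rule convergentI)
qed

lemma bij_left_translation: "bij (\<lambda>x. - y + x)" for y :: "'g::group_add"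
  by (rule bij_betw_byWitness[where f' = "\<lambda>x. y + x"]) (auto simp: add.assoc[symmetric])

lemma
  fixes f g :: "'g::group_add \<Rightarrow> complex"
  assumes f: "f abs_summable_on UNIV" and g: "g abs_summable_on UNIV"
  shows conv_summable_pair: "(\<lambda>(y, x). f y * g (- y + x)) abs_summable_on UNIV \<times> UNIV"
    and conv_summable_fst: "(\<lambda>y. f y * g (- y + x)) abs_summable_on UNIV"
    and conv_summable: "(\<lambda>x. \<Sum>\<^sub>\<infinity>y. f y * g (- y + x)) abs_summable_on UNIV"
    and conv_norm_le: "(\<Sum>\<^sub>\<infinity>x. cmod (\<Sum>\<^sub>\<infinity>y. f y * g (- y + x))) \<le>
      (\<Sum>\<^sub>\<infinity>x. cmod (f x)) * (\<Sum>\<^sub>\<infinity>x. cmod (g x))"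
proof -
  have tr: "(\<lambda>x. g (- y + x)) abs_summable_on UNIV" for y
    using summable_on_reindex_bij_betw[OF bij_left_translation, of "\<lambda>x. cmod (g x)" y] g by simp
  have trs: "(\<Sum>\<^sub>\<infinity>x. cmod (g (- y + x))) = (\<Sum>\<^sub>\<infinity>x. cmod (g x))" for y
    by (rule infsum_reindex_bij_betw[OF bij_left_translation])
  show pair: "(\<lambda>(y, x). f y * g (- y + x)) abs_summable_on UNIV \<times> UNIV"
    using summable_on_cmult_left[OF f] abs_summable_cmult[OF tr]
    by (subst abs_summable_on_Sigma_iff) (simp add: norm_mult infsum_cmult_right' trs infsum_nonneg)
  have swapped: "(\<lambda>(x, y). f y * g (- y + x)) abs_summable_on UNIV \<times> UNIV"
    using pair summable_on_reindex_bij_betw[OF bij_swap, of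
        "\<lambda>p. cmod (case p of (x, y) \<Rightarrow> f y * g (- y + x))"]
    by (simp add: case_prod_unfold)
  show fst: "(\<lambda>y. f y * g (- y + x)) abs_summable_on UNIV" for x
    using swapped by (subst (asm) abs_summable_on_Sigma_iff) auto
  have outer: "(\<lambda>x. \<Sum>\<^sub>\<infinity>y. cmod (f y * g (- y + x))) summable_on UNIV"
    using swapped by (subst (asm) abs_summable_on_Sigma_iff) (simp add: infsum_nonneg)
  show conv: "(\<lambda>x. \<Sum>\<^sub>\<infinity>y. f y * g (- y + x)) abs_summable_on UNIV"
    by (rule abs_summable_on_comparison_test'[OF outer]) (rule norm_infsum_bound[OF fst])
  have "(\<Sum>\<^sub>\<infinity>x. cmod (\<Sum>\<^sub>\<infinity>y. f y * g (- y + x))) \<le> (\<Sum>\<^sub>\<infinity>x. \<Sum>\<^sub>\<infinity>y. cmod (f y * g (- y + x)))"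
    by (rule infsum_mono[OF conv outer]) (rule norm_infsum_bound[OF fst])
  also have "\<dots> = (\<Sum>\<^sub>\<infinity>y. \<Sum>\<^sub>\<infinity>x. cmod (f y * g (- y + x)))"
    using swapped by (intro infsum_swap_banach) (simp add: case_prod_unfold)
  also have "\<dots> = (\<Sum>\<^sub>\<infinity>x. cmod (f x)) * (\<Sum>\<^sub>\<infinity>x. cmod (g x))"
    by (simp add: norm_mult infsum_cmult_right' infsum_cmult_left' trs)
  finally show "(\<Sum>\<^sub>\<infinity>x. cmod (\<Sum>\<^sub>\<infinity>y. f y * g (- y + x))) \<le>
      (\<Sum>\<^sub>\<infinity>x. cmod (f x)) * (\<Sum>\<^sub>\<infinity>x. cmod (g x))" .
qed

lemma conv_assoc:
  fixes f g h :: "'g::group_add \<Rightarrow> complex"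
  assumes f: "f abs_summable_on UNIV" and g: "g abs_summable_on UNIV" and h: "h abs_summable_on UNIV"
  shows "(\<Sum>\<^sub>\<infinity>z. (\<Sum>\<^sub>\<infinity>y. f y * g (- y + z)) * h (- z + x)) =
    (\<Sum>\<^sub>\<infinity>y. f y * (\<Sum>\<^sub>\<infinity>w. g w * h (- w + (- y + x))))"
proof -
  have h_le: "cmod (h u) \<le> (\<Sum>\<^sub>\<infinity>u. cmod (h u))" for u
    using finite_sum_le_infsum[OF h, of "{u}"] by simp
  have "(\<lambda>(y, z). f y * g (- y + z) * h (- z + x)) abs_summable_on UNIV \<times> UNIV"
    by (rule abs_summable_on_comparison_test'[OF
          summable_on_cmult_left[OF conv_summable_pair[OF f g], of "\<Sum>\<^sub>\<infinity>u. cmod (h u)"]])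
      (auto simp: norm_mult intro!: mult_left_mono h_le)
  then have "(\<lambda>(y, z). f y * g (- y + z) * h (- z + x)) summable_on UNIV \<times> UNIV"
    by (rule abs_summable_summable)
  then have "(\<Sum>\<^sub>\<infinity>z. \<Sum>\<^sub>\<infinity>y. f y * g (- y + z) * h (- z + x)) =
      (\<Sum>\<^sub>\<infinity>y. \<Sum>\<^sub>\<infinity>z. f y * g (- y + z) * h (- z + x))"
    by (rule infsum_swap_banach[symmetric])
  moreover have "(\<Sum>\<^sub>\<infinity>w. g w * h (- w + (- y + x))) = (\<Sum>\<^sub>\<infinity>z. g (- y + z) * h (- z + x))" for y
    using infsum_reindex_bij_betw[OF bij_left_translation,
        of "\<lambda>w. g w * h (- w + (- y + x))" y]
    by (simp add: minus_add add.assoc[symmetric])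
  ultimately show ?thesis
    by (simp add: infsum_cmult_left' infsum_cmult_right' mult.assoc flip: infsum_cmult_left')
qed

instantiation ell1 :: (group_add) complex_normed_algebra
begin

lift_definition times_ell1 :: "'a ell1 \<Rightarrow> 'a ell1 \<Rightarrow> 'a ell1" is
  "\<lambda>f g x. \<Sum>\<^sub>\<infinity>y. f y * g (- y + x)"
  by (rule conv_summable)

instance
proof
  fix f g h :: "'a ell1" and r :: real and c :: complex
  show "f * g * h = f * (g * h)"
    by transfer (simp add: conv_assoc)
  show "(f + g) * h = f * h + g * h"
    by transfer (simp add: distrib_right infsum_add abs_summable_summable conv_summable_fst)
  show "f * (g + h) = f * g + f * h"
    by transfer (simp add: distrib_left infsum_add abs_summable_summable conv_summable_fst)
  show *: "c *\<^sub>C f * g = c *\<^sub>C (f * g)" for c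
    by transfer (simp add: mult.assoc infsum_cmult_right')
  show **: "f * c *\<^sub>C g = c *\<^sub>C (f * g)" for c
    by transfer (rule ext, subst infsum_cmult_right'[symmetric], simp only: mult_ac)
  show "r *\<^sub>R f * g = r *\<^sub>R (f * g)" using *[of "of_real r"] by (simp add: scaleC_of_real)
  show "f * r *\<^sub>R g = r *\<^sub>R (f * g)" using **[of "of_real r"] by (simp add: scaleC_of_real)
  show "norm (f * g) \<le> norm f * norm g"
    by transfer (rule conv_norm_le)
qed

end

lift_definition delta :: "'g \<Rightarrow> 'g ell1" is "\<lambda>s x. if x = s then 1 else 0"
proof -
  fix s :: 'g
  have "(\<lambda>x. cmod (if x = s then 1 else 0)) summable_on UNIV \<longleftrightarrow>
      (\<lambda>x. cmod (if x = s then 1 else 0)) summable_on {s}"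
    by (rule summable_on_cong_neutral) auto
  then show "(\<lambda>x. if x = s then 1 else 0 :: complex) abs_summable_on UNIV"
    by simp
qed

instantiation ell1 :: (group_add) real_normed_algebra_1
begin

definition one_ell1 :: "'a ell1" where "one_ell1 = delta 0"

instance
proof
  fix f :: "'a ell1"
  have single: "(\<Sum>\<^sub>\<infinity>y. F y) = F s" if "\<And>y. y \<noteq> s \<Longrightarrow> F y = 0"
    for F :: "'a \<Rightarrow> 'b::{t2_space, comm_monoid_add}" and s
    using infsum_cong_neutral[of "{s}" UNIV F F] that by simp
  show "1 * f = f"
    unfolding one_ell1_def
  proof (transfer, rule ext)
    fix f :: "'a \<Rightarrow> complex" and x :: 'a
    show "(\<Sum>\<^sub>\<infinity>y. (if y = 0 then 1 else 0) * f (- y + x)) = f x"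
      by (subst single[of 0]) auto
  qed
  show "f * 1 = f"
    unfolding one_ell1_def
  proof (transfer, rule ext)
    fix f :: "'a \<Rightarrow> complex" and x :: 'a
    have "- y + x = 0 \<longleftrightarrow> y = x" for y
      using neg_eq_iff_add_eq_0[of "- y" x] by simp
    then show "(\<Sum>\<^sub>\<infinity>y. f y * (if - y + x = 0 then 1 else 0)) = f x"
      by (subst single[of x]) auto
  qed
  have norm1: "norm (1 :: 'a ell1) = 1"
    unfolding one_ell1_def by transfer (subst single[of 0], simp_all)
  then show "norm (1 :: 'a ell1) = 1" .
  show "(0 :: 'a ell1) \<noteq> 1"
    using norm1 norm_eq_zero[of "1 :: 'a ell1"] by (metis zero_neq_one)
qed

end

section \<open>The radical\<close>

text \<open>Unital Banach algebras are described by a sort without \<^class>\<open>real_normed_algebra_1\<close>,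
  since \<open>norm 1 = 1\<close> in the bidual of an arbitrary algebra would need the Hahn-Banach theorem.\<close>

definition quasi_nilpotent :: "'b::{real_normed_algebra, monoid_mult, banach} \<Rightarrow> bool" where
  "quasi_nilpotent a \<longleftrightarrow> (\<lambda>n. root n (norm (a ^ n))) \<longlonglongrightarrow> 0"

definition jacobson_radical :: "'b::{real_normed_algebra, monoid_mult, banach} set" where
  "jacobson_radical = {a. \<forall>b. quasi_nilpotent (b * a)}"

definition nilpotent :: "'b::{monoid_mult, zero} \<Rightarrow> bool" where
  "nilpotent a \<longleftrightarrow> (\<exists>n>0. a ^ n = 0)"

end

theory Submission
  imports Defs "HOL-Analysis.Function_Topology" "HOL-Analysis.Topology_Euclidean_Space"
begin

text \<open>
  In the bidual of a commutative group algebra, a weak-star limit of functions on a subgroup that is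
  invariant under this subgroup and annihilates the constants generates a nilpotent ideal. The
  group \<open>\<Oplus>\<^sub>i \<int>\<close> has infinitely many independent directions, and each of them supplies such a functional; a norm convergent sum of them stays in the radical but
  is no longer nilpotent.

  For each coordinate \<open>i\<close>, let \<open>a\<^sub>n\<close> be the average of the point masses at \<open>0, e\<^sub>i, \<dots>, n e\<^sub>i\<close> minus
  the average of those at \<open>- e\<^sub>i, \<dots>, - (n + 1) e\<^sub>i\<close>, and let \<open>\<Lambda>\<^sub>i\<close> be a weak-star cluster point of
  the \<open>a\<^sub>n\<close>. It is the difference of two means on \<open>\<int> e\<^sub>i\<close>, one living at \<open>+\<infinity>\<close> and one at
  \<open>-\<infinity>\<close>. Since \<open>a\<^sub>m\<close> has total mass 0 and the \<open>a\<^sub>n\<close> are asymptotically invariant,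
  \<open>a\<^sub>m * a\<^sub>n \<rightarrow> 0\<close>, so that \<open>a\<^sub>m * \<Lambda>\<^sub>i = 0\<close>. Elements of the group algebra are central in
  the bidual and the Arens product is weak-star continuous in its first factor, so
  \<open>\<Lambda>\<^sub>i * w * \<Lambda>\<^sub>i = lim w * a\<^sub>m * \<Lambda>\<^sub>i = 0\<close> for all \<open>w\<close>.

  In any Banach algebra, a convergent sum \<open>T = \<Sum>\<^sub>i c\<^sub>i \<Lambda>\<^sub>i\<close> of elements with this property is in
  the radical (\<open>suminf_in_jacobson_radical\<close>): in \<open>b * T\<close> the tail of the sum has small norm, and
  adding back one of the finitely many remaining terms does not raise the spectral radius.

  The powers of \<open>T\<close> are detected by the orthants \<open>{x. \<forall>i\<in>F. 0 \<le> x\<^sub>i}\<close>, viewed as functionals.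
  Acting with \<open>\<Lambda>\<^sub>i\<close> deletes the constraint in direction \<open>i\<close>, and gives 0 if there is
  none (\<open>exists_axis_element\<close>). Hence only the \<open>n!\<close> orderings of the \<open>n\<close> elements of \<open>F\<close> contribute
  to the value of \<open>T ^ n\<close> on the orthant of \<open>F\<close>, and this value is \<open>n! \<Prod>\<^sub>i\<^sub>\<in>\<^sub>F c\<^sub>i \<noteq> 0\<close>
  (\<open>power_on_orthant\<close>).
\<close>

section \<open>Sums of elements that generate square-zero ideals\<close>

text \<open>This says that the spectral radius of \<open>x\<close> is at most \<open>r\<close>, in the form of growth bounds, which
  can be combined term by term.\<close>

definition powers_bounded_beyond :: "'b::{real_normed_algebra, monoid_mult, banach} \<Rightarrow> real \<Rightarrow> bool" where
  "powers_bounded_beyond x r \<longleftrightarrow> (\<forall>\<rho>>r. \<exists>K. \<forall>n. norm (x ^ n) \<le> K * \<rho> ^ n)"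

lemma powers_bounded_beyond_norm:
  assumes "norm x \<le> r"
  shows "powers_bounded_beyond x r"
  unfolding powers_bounded_beyond_def
proof (intro allI impI exI)
  fix \<rho> :: real and n
  assume "\<rho> > r"
  with assms have \<rho>: "norm x \<le> \<rho>" "0 \<le> \<rho>" using norm_ge_zero[of x] by linarith+
  show "norm (x ^ n) \<le> norm (1::'a) * \<rho> ^ n"
  proof (induction n)
    case (Suc n)
    have "norm (x ^ Suc n) \<le> norm x * norm (x ^ n)" by (simp add: norm_mult_ineq)
    also have "\<dots> \<le> \<rho> * (norm (1::'a) * \<rho> ^ n)"
      using Suc \<rho> by (intro mult_mono) auto
    finally show ?case by (simp add: mult_ac)
  qed simp
qed

text \<open>In the noncommutative expansion of the power, every word with two letters \<open>z\<close> vanishes.\<close>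

lemma power_add_square_zero:
  fixes y z :: "'b::{real_normed_algebra, monoid_mult}"
  assumes z: "\<And>w. z * w * z = 0"
  shows "(y + z) ^ n = y ^ n + (\<Sum>k<n. y ^ k * z * y ^ (n - Suc k))"
proof (induction n)
  case (Suc n)
  have "(\<Sum>k<n. y ^ k * z * y ^ (n - Suc k)) * z = (\<Sum>k<n. y ^ k * (z * y ^ (n - Suc k) * z))"
    by (simp add: sum_distrib_right mult.assoc)
  then have zz: "(\<Sum>k<n. y ^ k * z * y ^ (n - Suc k)) * z = 0" by (simp add: z)
  have "(\<Sum>k<n. y ^ k * z * y ^ (n - Suc k)) * y = (\<Sum>k<n. y ^ k * z * y ^ (Suc n - Suc k))"
    unfolding sum_distrib_right
    by (intro sum.cong refl) (simp add: mult.assoc Suc_diff_Suc flip: power_Suc2)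
  then show ?case
    unfolding power_Suc2[of "y + z"] Suc by (simp add: distrib_left distrib_right zz power_Suc2 del: power_Suc)
qed simp

text \<open>Each of the \<open>n\<close> extra terms in the expansion has norm of order \<open>\<sigma> ^ n\<close> for any
  \<open>\<sigma> > r\<close>; the factor \<open>n\<close> is absorbed by passing to a slightly larger base, which the
  definition leaves room for.\<close>

lemma powers_bounded_beyond_add_square_zero:
  fixes y z :: "'b::{real_normed_algebra, monoid_mult, banach}"
  assumes y: "powers_bounded_beyond y r" and r: "r \<ge> 0" and z: "\<And>w. z * w * z = 0"
  shows "powers_bounded_beyond (y + z) r"
  unfolding powers_bounded_beyond_def
proof (intro allI impI)
  fix \<rho> assume "\<rho> > r"
  then obtain \<sigma> where \<sigma>: "r < \<sigma>" "\<sigma> < \<rho>" using dense by blast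
  have \<sigma>0: "\<sigma> > 0" using r \<sigma> by linarith
  obtain K where K: "\<And>n. norm (y ^ n) \<le> K * \<sigma> ^ n"
    using y \<sigma> unfolding powers_bounded_beyond_def by blast
  have K0: "K \<ge> 0" using K[of 0] norm_ge_zero[of "1::'b"] by (simp del: norm_ge_zero)
  have "(\<lambda>n. real n * (\<sigma> / \<rho>) ^ n) \<longlonglongrightarrow> 0"
    using \<sigma> \<sigma>0 by (intro powser_times_n_limit_0) auto
  then obtain B where B: "\<And>n. \<bar>real n * (\<sigma> / \<rho>) ^ n\<bar> \<le> B"
    using Bseq_def convergentI convergent_imp_Bseq by (metis real_norm_def)
  have nB: "real n * \<sigma> ^ n \<le> B * \<rho> ^ n" for n
    using B[of n] \<sigma> \<sigma>0 by (simp add: power_divide field_simps)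
  define D where "D = K * K * norm z / \<sigma>"
  have D0: "D \<ge> 0" using K0 \<sigma>0 by (simp add: D_def)
  have summand: "norm (y ^ k * z * y ^ (n - Suc k)) \<le> D * \<sigma> ^ n" if "k < n" for k n
  proof -
    have "norm (y ^ k * z * y ^ (n - Suc k)) \<le> norm (y ^ k) * norm z * norm (y ^ (n - Suc k))"
      by (meson mult_right_mono norm_ge_zero norm_mult_ineq order_trans)
    also have "\<dots> \<le> (K * \<sigma> ^ k) * norm z * (K * \<sigma> ^ (n - Suc k))"
      using K K0 \<sigma>0 by (intro mult_mono) auto
    also have "\<dots> = D * (\<sigma> ^ k * \<sigma> * \<sigma> ^ (n - Suc k))"
      using \<sigma>0 by (simp add: D_def)
    also have "\<sigma> ^ k * \<sigma> * \<sigma> ^ (n - Suc k) = \<sigma> ^ n"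
      using that by (metis add_Suc_right add_Suc_shift le_add_diff_inverse less_eq_Suc_le plus_1_eq_Suc power_Suc2 power_add)
    finally show ?thesis .
  qed
  have "norm ((y + z) ^ n) \<le> (K + D * B) * \<rho> ^ n" for n
  proof -
    have "norm ((y + z) ^ n) \<le> norm (y ^ n) + (\<Sum>k<n. norm (y ^ k * z * y ^ (n - Suc k)))"
      unfolding power_add_square_zero[OF z]
      by (rule order_trans[OF norm_triangle_ineq add_left_mono[OF norm_sum]])
    also have "\<dots> \<le> K * \<sigma> ^ n + real n * (D * \<sigma> ^ n)"
      using K sum_bounded_above[of "{..<n}" "\<lambda>k. norm (y ^ k * z * y ^ (n - Suc k))" "D * \<sigma> ^ n"] summand
      by (intro add_mono) auto
    also have "\<dots> = K * \<sigma> ^ n + D * (real n * \<sigma> ^ n)" by simp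
    also have "\<dots> \<le> K * \<rho> ^ n + D * (B * \<rho> ^ n)"
      using K0 D0 nB \<sigma> \<sigma>0 by (intro add_mono mult_left_mono power_mono) auto
    finally show ?thesis by (simp add: algebra_simps)
  qed
  then show "\<exists>K. \<forall>n. norm ((y + z) ^ n) \<le> K * \<rho> ^ n" by blast
qed

lemma quasi_nilpotentI:
  assumes "\<And>r. r > 0 \<Longrightarrow> powers_bounded_beyond x r"
  shows "quasi_nilpotent x"
  unfolding quasi_nilpotent_def
proof (rule LIMSEQ_I)
  fix e :: real assume e: "e > 0"
  \<comment> \<open>The base \<open>e / 3\<close> leaves room for the constant \<open>K\<close>, whose \<open>n\<close>-th root is eventually below 2.\<close>
  obtain K where K: "\<And>n. norm (x ^ n) \<le> K * (e / 3) ^ n"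
    using assms[of "e / 4"] e unfolding powers_bounded_beyond_def by fastforce
  define K' where "K' = max K 1"
  have "(\<lambda>n. root n K') \<longlonglongrightarrow> 1" by (rule LIMSEQ_root_const) (simp add: K'_def)
  then have "eventually (\<lambda>n. root n K' < 2) sequentially" by (rule order_tendstoD) simp
  then obtain N where N: "\<And>n. n \<ge> N \<Longrightarrow> root n K' < 2"
    unfolding eventually_sequentially by blast
  have "norm (root n (norm (x ^ n)) - 0) < e" if n: "n \<ge> max N 1" for n
  proof -
    have "norm (x ^ n) \<le> K' * (e / 3) ^ n"
      using K[of n] e unfolding K'_def
      by (meson divide_nonneg_nonneg less_eq_real_def max.cobounded1 mult_right_mono order_trans zero_le_numeral zero_le_power)
    then have "root n (norm (x ^ n)) \<le> root n K' * (e / 3)"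
      using n e by (metis (no_types) One_nat_def Suc_le_eq divide_nonneg_nonneg less_eq_real_def max.bounded_iff
          real_root_le_mono real_root_mult real_root_power_cancel zero_le_numeral)
    also have "\<dots> \<le> 2 * (e / 3)" using N[of n] n e by (intro mult_right_mono) auto
    also have "\<dots> < e" using e by simp
    finally show ?thesis using n by simp
  qed
  then show "\<exists>no. \<forall>n\<ge>no. norm (root n (norm (x ^ n)) - 0) < e" by blast
qed

text \<open>Given \<open>b\<close> and \<open>r > 0\<close>, a tail of \<open>b * suminf L\<close> has norm at most \<open>r\<close>. The finitely many other
  terms \<open>b * L i\<close> also satisfy \<open>z * w * z = 0\<close>, so they can be added one at a time without
  changing the bound \<open>r\<close> on the spectral radius.\<close>

theorem suminf_in_jacobson_radical:
  fixes L :: "nat \<Rightarrow> 'b::{real_normed_algebra, monoid_mult, banach}"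
  assumes sum: "summable L" and L: "\<And>i w. L i * w * L i = 0"
  shows "suminf L \<in> jacobson_radical"
  unfolding jacobson_radical_def
proof (intro CollectI allI quasi_nilpotentI)
  fix b :: 'b and r :: real
  assume r: "r > 0"
  have bz: "b * L i * w * (b * L i) = 0" for i w
    using L[of i "w * b"] by (simp add: mult.assoc)
  have "(\<lambda>n. b * (suminf L - (\<Sum>i<n. L i))) \<longlonglongrightarrow> b * (suminf L - suminf L)"
    by (intro tendsto_intros summable_LIMSEQ sum)
  then have "(\<lambda>n. b * (suminf L - (\<Sum>i<n. L i))) \<longlonglongrightarrow> 0" by simp
  then obtain N where N: "norm (b * (suminf L - (\<Sum>i<N. L i))) \<le> r"
    using LIMSEQ_D[OF _ r] by (metis diff_zero less_eq_real_def order_refl)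
  have "powers_bounded_beyond (b * (suminf L - (\<Sum>i<N. L i)) + (\<Sum>i<m. b * L i)) r" for m
  proof (induction m)
    case 0
    show ?case using powers_bounded_beyond_norm[OF N] by simp
  next
    case (Suc m)
    from powers_bounded_beyond_add_square_zero[OF Suc _ bz[of m]] r show ?case
      by (simp add: add.assoc)
  qed
  from this[of N] show "powers_bounded_beyond (b * suminf L) r"
    by (simp add: sum_distrib_left right_diff_distrib)
qed

section \<open>Weak-star limits\<close>

lemma bounded_linear_cdual_apply: "bounded_linear (cdual_apply l)"
  by (rule bounded_clinear_imp_bounded_linear[OF bounded_clinear_cdual_apply])

text \<open>The Banach-Alaoglu theorem, by Tychonov compactness of a product of discs. The limit is taken
  along a filter finer than \<open>sequentially\<close>, because the weak-star compact ball need not be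
  sequentially compact.\<close>

lemma exists_weak_star_limit:
  fixes \<phi> :: "nat \<Rightarrow> 'a::complex_normed_vector cdual"
  assumes \<phi>: "\<And>n. norm (\<phi> n) \<le> C"
  shows "\<exists>L U. norm L \<le> C \<and> U \<noteq> bot \<and> U \<le> sequentially \<and>
    (\<forall>x. ((\<lambda>n. cdual_apply (\<phi> n) x) \<longlongrightarrow> cdual_apply L x) U)"
proof -
  have C0: "C \<ge> 0" using \<phi>[of 0] norm_ge_zero order_trans by blast
  define B where "B = PiE UNIV (\<lambda>x::'a. cball (0::complex) (C * norm x))"
  have "compactin (product_topology (\<lambda>_::'a. euclidean) UNIV) B"
    unfolding B_def by (subst compactin_PiE) auto
  then have cB: "compact B" by (simp add: euclidean_product_topology)
  have inB: "cdual_apply (\<phi> n) \<in> B" for n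
    using norm_cdual_apply_le[of "\<phi> n"] \<phi>[of n]
    by (simp add: B_def PiE_iff) (meson mult_right_mono norm_ge_zero order_trans)
  have "filtermap (\<lambda>n. cdual_apply (\<phi> n)) sequentially \<noteq> bot"
    by (simp add: filtermap_bot_iff)
  moreover have "eventually (\<lambda>g. g \<in> B) (filtermap (\<lambda>n. cdual_apply (\<phi> n)) sequentially)"
    unfolding eventually_filtermap by (simp add: inB)
  ultimately obtain f where f: "f \<in> B"
      "inf (nhds f) (filtermap (\<lambda>n. cdual_apply (\<phi> n)) sequentially) \<noteq> bot"
    using cB unfolding compact_filter le_principal by blast
  \<comment> \<open>The cluster point \<open>f\<close> is the limit along the indices \<open>n\<close> at which \<open>\<phi> n\<close> is near \<open>f\<close>.\<close>
  define U where "U = inf (filtercomap (\<lambda>n. cdual_apply (\<phi> n)) (nhds f)) sequentially"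
  have U: "U \<noteq> bot" "U \<le> sequentially"
  proof -
    show "U \<noteq> bot"
    proof
      assume "U = bot"
      then have "eventually (\<lambda>_. False) U" by simp
      then obtain P Q where P: "eventually P (nhds f)" and Q: "eventually Q sequentially"
          and PQ: "\<And>n. P (cdual_apply (\<phi> n)) \<Longrightarrow> Q n \<Longrightarrow> False"
        unfolding U_def eventually_inf eventually_filtercomap by blast
      have "eventually (\<lambda>g. \<not> P g) (filtermap (\<lambda>n. cdual_apply (\<phi> n)) sequentially)"
        unfolding eventually_filtermap using Q by eventually_elim (use PQ in blast)
      with P have "eventually (\<lambda>_. False)
          (inf (nhds f) (filtermap (\<lambda>n. cdual_apply (\<phi> n)) sequentially))"
        unfolding eventually_inf by blast
      with f(2) show False by (simp add: eventually_False)
    qed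
  qed (simp add: U_def)
  have lim: "((\<lambda>n. cdual_apply (\<phi> n) x) \<longlongrightarrow> f x) U" for x
  proof -
    have "((\<lambda>n. cdual_apply (\<phi> n)) \<longlongrightarrow> f) U"
      by (simp add: filterlim_iff_le_filtercomap U_def)
    moreover have "((\<lambda>g. g x) \<longlongrightarrow> f x) (nhds f)"
    proof (rule topological_tendstoI)
      fix S :: "complex set" assume S: "open S" "f x \<in> S"
      have "open ((\<lambda>g::'a \<Rightarrow> complex. g x) -` S)"
        using open_vimage[OF S(1) continuous_on_product_coordinates] .
      with S(2) show "eventually (\<lambda>g. g x \<in> S) (nhds f)"
        unfolding eventually_nhds by blast
    qed
    ultimately show ?thesis by (rule filterlim_compose[rotated])
  qed
  have "bounded_clinear f"
  proof (rule bounded_clinearI)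
    show "f (x + y) = f x + f y" for x y
      using tendsto_unique[OF U(1) lim[of "x + y"]] tendsto_add[OF lim[of x] lim[of y]]
      by (simp add: cdual_apply_add_right)
    show "f (c *\<^sub>C x) = c * f x" for c x
      using tendsto_unique[OF U(1) lim[of "c *\<^sub>C x"]] tendsto_mult_left[OF lim[of x], of c]
      by (simp add: cdual_apply_scaleC_right)
    show "norm (f x) \<le> norm x * C" for x
      using f(1) by (auto simp: B_def PiE_iff mult.commute)
  qed
  then have Lf: "cdual_apply (Abs_cdual f) = f" by (simp add: Abs_cdual_inverse)
  have "norm (Abs_cdual f) \<le> C"
    using f(1) C0 by (intro norm_cdual_bound) (auto simp: Lf B_def PiE_iff)
  with U lim show ?thesis by (intro exI[of _ "Abs_cdual f"] exI[of _ U]) (simp add: Lf)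
qed

lemma norm_canonical_embedding_le: "norm (canonical_embedding a) \<le> norm a"
  by (rule norm_cdual_bound) (simp_all add: canonical_embedding.rep_eq norm_cdual_apply_le mult.commute[of "norm a"])

lemma arens_canonical_embedding_commute:
  assumes comm: "\<And>x y :: 'a::complex_normed_algebra. x * y = y * x"
  shows "arens (canonical_embedding a) \<Psi> = arens \<Psi> (canonical_embedding (a::'a))"
proof (rule cdual_eqI)
  fix l :: "'a cdual"
  have "bidual_act (canonical_embedding a) l = dual_act l a"
    by (rule cdual_eqI) (simp add: bidual_act.rep_eq canonical_embedding.rep_eq dual_act.rep_eq comm)
  then show "cdual_apply (arens (canonical_embedding a) \<Psi>) l
      = cdual_apply (arens \<Psi> (canonical_embedding a)) l"
    by (simp add: arens.rep_eq canonical_embedding.rep_eq bidual_act.rep_eq)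
qed

text \<open>Every \<open>a m\<close> annihilates \<open>\<Lambda>\<close> by \<open>null\<close>. Replacing the first factor of
  \<open>\<Lambda> \<Psi> \<Lambda>\<close> by \<open>a m\<close>, in which the product is weak-star continuous, and moving the central element
  \<open>a m\<close> past \<open>\<Psi>\<close> gives 0 before the limit.\<close>

lemma arens_sandwich_weak_star_limit_eq_0:
  fixes a :: "nat \<Rightarrow> 'a::complex_normed_algebra"
  assumes comm: "\<And>x y :: 'a. x * y = y * x"
    and null: "\<And>m. (\<lambda>n. a m * a n) \<longlonglongrightarrow> 0"
    and U: "U \<noteq> bot" "U \<le> sequentially"
    and lim: "\<And>l. ((\<lambda>n. cdual_apply l (a n)) \<longlongrightarrow> cdual_apply \<Lambda> l) U"
  shows "arens (arens \<Lambda> \<Psi>) \<Lambda> = 0"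
proof -
  have ann: "arens (canonical_embedding (a m)) \<Lambda> = 0" for m
  proof (rule cdual_eqI)
    fix l :: "'a cdual"
    have "(\<lambda>n. cdual_apply l (a m * a n)) \<longlonglongrightarrow> cdual_apply l 0"
      by (rule bounded_linear.tendsto[OF bounded_linear_cdual_apply null])
    then have "((\<lambda>n. cdual_apply l (a m * a n)) \<longlongrightarrow> 0) U"
      using U(2) by (simp add: cdual_apply_zero_right tendsto_mono)
    then have "cdual_apply \<Lambda> (dual_act l (a m)) = 0"
      using lim[of "dual_act l (a m)"] tendsto_unique[OF U(1)] by (simp add: dual_act.rep_eq)
    then show "cdual_apply (arens (canonical_embedding (a m)) \<Lambda>) l = cdual_apply 0 l"
      by (simp add: arens.rep_eq canonical_embedding.rep_eq bidual_act.rep_eq zero_cdual.rep_eq)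
  qed
  show ?thesis
  proof (rule cdual_eqI)
    fix l :: "'a cdual"
    have "cdual_apply (bidual_act (arens \<Psi> \<Lambda>) l) (a m) = 0" for m
    proof -
      have "cdual_apply (bidual_act (arens \<Psi> \<Lambda>) l) (a m)
          = cdual_apply (arens (arens (canonical_embedding (a m)) \<Psi>) \<Lambda>) l"
        by (simp add: arens_assoc arens.rep_eq[of "canonical_embedding _"] canonical_embedding.rep_eq)
      also have "\<dots> = cdual_apply (arens \<Psi> (arens (canonical_embedding (a m)) \<Lambda>)) l"
        by (simp add: arens_canonical_embedding_commute[OF comm] arens_assoc)
      also have "\<dots> = 0"
      proof -
        have "bidual_act (0 :: 'a cdual cdual) l = 0"
          by (rule cdual_eqI) (simp add: bidual_act.rep_eq zero_cdual.rep_eq)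
        then show ?thesis by (simp add: ann arens.rep_eq cdual_apply_zero_right)
      qed
      finally show ?thesis .
    qed
    then have "((\<lambda>n. 0) \<longlongrightarrow> cdual_apply \<Lambda> (bidual_act (arens \<Psi> \<Lambda>) l)) U"
      using lim[of "bidual_act (arens \<Psi> \<Lambda>) l"] by simp
    then have "cdual_apply \<Lambda> (bidual_act (arens \<Psi> \<Lambda>) l) = 0"
      by (rule tendsto_unique[OF U(1) _ tendsto_const])
    then show "cdual_apply (arens (arens \<Lambda> \<Psi>) \<Lambda>) l = cdual_apply 0 l"
      by (simp add: arens_assoc arens.rep_eq[of \<Lambda>] zero_cdual.rep_eq)
  qed
qed

section \<open>Differences of averages over the two halves of a cyclic group\<close>

text \<open>With \<open>v\<close> the inverse of \<open>u\<close>, the exponents \<open>0, \<dots>, n\<close> and \<open>- 1, \<dots>, - (n + 1)\<close> of \<open>u\<close> occur. The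
  two ranges are disjoint and together cover all integers as \<open>n\<close> grows, so that the half line of
  nonnegative exponents separates them exactly.\<close>

definition half_difference :: "'a::real_normed_algebra_1 \<Rightarrow> 'a \<Rightarrow> nat \<Rightarrow> 'a" where
  "half_difference u v n = inverse (real (Suc n)) *\<^sub>R (\<Sum>k\<le>n. u ^ k - v ^ Suc k)"

text \<open>The left factor has coefficient sum 0, hence is of the form \<open>c * (u - 1)\<close>. In the product of
  \<open>u - 1\<close> with the right factor all but the boundary terms cancel, and these have total norm at
  most 4 before division by \<open>n + 1\<close>.\<close>

lemma
  fixes u v :: "'a::real_normed_algebra_1"
  assumes uv: "u * v = 1" and vu: "v * u = 1" and u: "norm u \<le> 1" and v: "norm v \<le> 1"
  shows norm_half_difference_le: "norm (half_difference u v n) \<le> 2"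
    and half_difference_mult_tendsto_0: "(\<lambda>n. half_difference u v m * half_difference u v n) \<longlonglongrightarrow> 0"
proof -
  have pow: "norm (u ^ k) \<le> 1" "norm (v ^ k) \<le> 1" for k
    using u v norm_power_ineq[of u k] norm_power_ineq[of v k] power_le_one order_trans norm_ge_zero
    by metis+
  have "norm (\<Sum>k\<le>n. u ^ k - v ^ Suc k) \<le> (\<Sum>k\<le>n. 2)"
  proof (rule sum_norm_le)
    fix k
    show "norm (u ^ k - v ^ Suc k) \<le> 2"
      using norm_triangle_ineq4[of "u ^ k" "v ^ Suc k"] pow(1)[of k] pow(2)[of "Suc k"] by linarith
  qed
  then show "norm (half_difference u v n) \<le> 2"
    by (simp add: half_difference_def field_simps)
  have telescope: "(u - 1) * (\<Sum>k\<le>n. u ^ k - v ^ Suc k) = u ^ Suc n + v ^ Suc n - 2" for n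
  proof (induction n)
    case 0
    show ?case by (simp add: algebra_simps uv)
  next
    case (Suc n)
    have "u * (v * v ^ Suc n) = v ^ Suc n" by (simp add: uv flip: mult.assoc)
    then have "(u - 1) * (u ^ Suc n - v ^ Suc (Suc n)) = u ^ Suc (Suc n) - u ^ Suc n - v ^ Suc n + v ^ Suc (Suc n)"
      by (simp add: algebra_simps)
    then show ?case using Suc by (simp add: distrib_left)
  qed
  have "norm (u ^ Suc n + v ^ Suc n - 2) \<le> 4" for n
    using norm_triangle_ineq4[of "u ^ Suc n + v ^ Suc n" 2] norm_triangle_ineq[of "u ^ Suc n" "v ^ Suc n"]
      pow(1)[of "Suc n"] pow(2)[of "Suc n"] norm_numeral[of "num.Bit0 num.One", where 'a='a] by linarith
  then have "norm ((u - 1) * half_difference u v n) \<le> 4 * inverse (real (Suc n))" for n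
    unfolding half_difference_def mult_scaleR_right telescope norm_scaleR
    by (subst mult.commute, rule mult_mono) auto
  moreover have "(\<lambda>n. 4 * inverse (real (Suc n))) \<longlonglongrightarrow> 0"
    using tendsto_mult_right_zero[OF LIMSEQ_inverse_real_of_nat] by blast
  ultimately have inv: "(\<lambda>n. (u - 1) * half_difference u v n) \<longlonglongrightarrow> 0"
    by (rule Lim_null_comparison[OF always_eventually[OF allI]])
  have u1: "\<exists>c. u ^ k - 1 = c * (u - 1)" for k
  proof (induction k)
    case (Suc k)
    then obtain c where "u ^ k - 1 = c * (u - 1)" by blast
    moreover have "u ^ Suc k - 1 = u * (u ^ k - 1) + (u - 1)" by (simp add: right_diff_distrib)
    ultimately have "u ^ Suc k - 1 = (u * c + 1) * (u - 1)" by (simp add: distrib_right mult.assoc)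
    then show ?case by blast
  qed (auto intro: exI[of _ 0])
  have v1: "\<exists>c. v ^ k - 1 = c * (u - 1)" for k
  proof (induction k)
    case (Suc k)
    then obtain c where "v ^ k - 1 = c * (u - 1)" by blast
    moreover have "v ^ Suc k - 1 = v * (v ^ k - 1) - v * (u - 1)" by (simp add: right_diff_distrib vu)
    ultimately have "v ^ Suc k - 1 = (v * c - v) * (u - 1)" by (simp add: left_diff_distrib mult.assoc)
    then show ?case by blast
  qed (auto intro: exI[of _ 0])
  have "\<exists>c. u ^ k - v ^ Suc k = c * (u - 1)" for k
  proof -
    obtain c d where "u ^ k - 1 = c * (u - 1)" "v ^ Suc k - 1 = d * (u - 1)" using u1 v1 by metis
    then have "u ^ k - v ^ Suc k = (c - d) * (u - 1)"
      unfolding left_diff_distrib[of c] by (metis diff_diff_eq2 diff_add_cancel)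
    then show ?thesis by blast
  qed
  then obtain c where c: "\<And>k. u ^ k - v ^ Suc k = c k * (u - 1)" by metis
  have "half_difference u v m = (inverse (real (Suc m)) *\<^sub>R (\<Sum>k\<le>m. c k)) * (u - 1)"
    unfolding half_difference_def c by (simp add: sum_distrib_right)
  then show "(\<lambda>n. half_difference u v m * half_difference u v n) \<longlonglongrightarrow> 0"
    using tendsto_mult_right_zero[OF inv] by (simp only: mult.assoc)
qed

lemma average_tendsto:
  fixes t :: "nat \<Rightarrow> 'a::real_normed_vector"
  assumes "\<And>k. k \<ge> N \<Longrightarrow> t k = L"
  shows "(\<lambda>n. inverse (real (Suc n)) *\<^sub>R (\<Sum>k\<le>n. t k)) \<longlonglongrightarrow> L"
proof -
  define D where "D = (\<Sum>k<N. t k - L)"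
  have "inverse (real (Suc n)) *\<^sub>R (\<Sum>k\<le>n. t k) = L + inverse (real (Suc n)) *\<^sub>R D" if "n \<ge> N" for n
  proof -
    have "(\<Sum>k\<le>n. t k - L) = D"
      unfolding D_def using that assms by (intro sum.mono_neutral_right) auto
    then have "(\<Sum>k\<le>n. t k) = real (Suc n) *\<^sub>R L + D" by (simp add: sum_subtractf algebra_simps sum_constant_scaleR)
    then show ?thesis by (simp add: scaleR_add_right del: of_nat_Suc)
  qed
  then have ev: "eventually (\<lambda>n. L + inverse (real (Suc n)) *\<^sub>R D
      = inverse (real (Suc n)) *\<^sub>R (\<Sum>k\<le>n. t k)) sequentially"
    unfolding eventually_sequentially by (metis (mono_tags))
  have "(\<lambda>n. L + inverse (real (Suc n)) *\<^sub>R D) \<longlonglongrightarrow> L + 0 *\<^sub>R D"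
    by (intro tendsto_intros LIMSEQ_inverse_real_of_nat)
  then have "(\<lambda>n. L + inverse (real (Suc n)) *\<^sub>R D) \<longlonglongrightarrow> L" by simp
  then show ?thesis using tendsto_cong[OF ev] by blast
qed

section \<open>The group algebra and orthant functionals\<close>

lemma ell1_mult_commute:
  fixes f g :: "'g::ab_group_add ell1"
  shows "f * g = g * f"
proof (transfer, rule ext)
  fix f g :: "'g \<Rightarrow> complex" and x :: 'g
  have bij: "bij (\<lambda>y. x - y)" by (rule bij_betw_byWitness[where f' = "\<lambda>y. x - y"]) auto
  show "(\<Sum>\<^sub>\<infinity>y. f y * g (- y + x)) = (\<Sum>\<^sub>\<infinity>y. g y * f (- y + x))"
    using infsum_reindex_bij_betw[OF bij, of "\<lambda>y. f y * g (- y + x)"]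
    by (simp add: mult.commute)
qed

lemma delta_mult: "delta s * delta t = delta (s + t)"
proof (transfer, rule ext)
  fix s t x :: 'a
  have "(\<Sum>\<^sub>\<infinity>y. (if y = s then 1 else 0) * (if - y + x = t then 1 else (0::complex)))
      = (\<Sum>\<^sub>\<infinity>y\<in>{s}. (if y = s then 1 else 0) * (if - y + x = t then 1 else 0))"
    by (rule infsum_cong_neutral) auto
  also have "\<dots> = (if x = s + t then 1 else 0)" by (auto simp: add.assoc[symmetric])
  finally show "(\<Sum>\<^sub>\<infinity>y. (if y = s then 1 else 0) * (if - y + x = t then 1 else (0::complex)))
      = (if x = s + t then 1 else 0)" .
qed

lemma norm_delta: "norm (delta s) = 1"
proof transfer
  fix s :: 'a
  have "(\<Sum>\<^sub>\<infinity>x. cmod (if x = s then 1 else 0)) = (\<Sum>\<^sub>\<infinity>x\<in>{s}. cmod (if x = s then 1 else 0))"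
    by (rule infsum_cong_neutral) auto
  then show "(\<Sum>\<^sub>\<infinity>x. cmod (if x = s then 1 else 0)) = 1" by simp
qed

text \<open>The point masses span a dense subspace, so they determine bounded functionals.\<close>

lemma has_sum_delta: "((\<lambda>x. ell1_apply a x *\<^sub>C delta x) has_sum a) UNIV"
  unfolding has_sum_def
proof (rule LIM_zero_cancel, rule tendsto_norm_zero_cancel)
  have abs: "ell1_apply a abs_summable_on UNIV" using ell1_apply by blast
  have "norm ((\<Sum>x\<in>F. ell1_apply a x *\<^sub>C delta x) - a)
      = (\<Sum>\<^sub>\<infinity>x. cmod (ell1_apply a x)) - (\<Sum>x\<in>F. cmod (ell1_apply a x))" if F: "finite F" for F
  proof -
    have "ell1_apply (\<Sum>x\<in>F. ell1_apply a x *\<^sub>C delta x) y = (if y \<in> F then ell1_apply a y else 0)" for y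
      using F by (induction F rule: finite_induct)
        (auto simp: zero_ell1.rep_eq plus_ell1.rep_eq scaleC_ell1.rep_eq delta.rep_eq)
    then have "norm ((\<Sum>x\<in>F. ell1_apply a x *\<^sub>C delta x) - a)
        = (\<Sum>\<^sub>\<infinity>y. cmod ((if y \<in> F then ell1_apply a y else 0) - ell1_apply a y))"
      by (simp add: norm_ell1.rep_eq minus_ell1.rep_eq)
    also have "\<dots> = (\<Sum>\<^sub>\<infinity>y\<in>UNIV - F. cmod (ell1_apply a y))"
      by (rule infsum_cong_neutral) auto
    also have "\<dots> = (\<Sum>\<^sub>\<infinity>x. cmod (ell1_apply a x)) - (\<Sum>\<^sub>\<infinity>x\<in>F. cmod (ell1_apply a x))"
      using abs F by (intro infsum_Diff) auto
    finally show ?thesis using F by simp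
  qed
  then have ev: "eventually (\<lambda>F. (\<Sum>\<^sub>\<infinity>x. cmod (ell1_apply a x)) - (\<Sum>x\<in>F. cmod (ell1_apply a x))
      = norm ((\<Sum>x\<in>F. ell1_apply a x *\<^sub>C delta x) - a)) (finite_subsets_at_top UNIV)"
    by (intro eventually_finite_subsets_at_top_weakI) auto
  have "((\<lambda>F. (\<Sum>\<^sub>\<infinity>x. cmod (ell1_apply a x)) - (\<Sum>x\<in>F. cmod (ell1_apply a x)))
      \<longlongrightarrow> (\<Sum>\<^sub>\<infinity>x. cmod (ell1_apply a x)) - (\<Sum>\<^sub>\<infinity>x. cmod (ell1_apply a x))) (finite_subsets_at_top UNIV)"
    by (intro tendsto_intros infsum_tendsto abs)
  then show "((\<lambda>F. norm ((\<Sum>x\<in>F. ell1_apply a x *\<^sub>C delta x) - a)) \<longlongrightarrow> 0) (finite_subsets_at_top UNIV)"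
    using tendsto_cong[OF ev] by simp
qed

lemma ell1_functional_eqI:
  fixes l m :: "'g ell1 cdual"
  assumes "\<And>x. cdual_apply l (delta x) = cdual_apply m (delta x)"
  shows "l = m"
proof (rule cdual_eqI)
  fix a :: "'g ell1"
  have "((\<lambda>x. cdual_apply k (ell1_apply a x *\<^sub>C delta x)) has_sum cdual_apply k a) UNIV" for k :: "'g ell1 cdual"
    using has_sum_bounded_linear[OF bounded_linear_cdual_apply has_sum_delta]
    unfolding o_def by this
  from this[of l] this[of m] show "cdual_apply l a = cdual_apply m a"
    unfolding cdual_apply_scaleC_right assms by (rule has_sum_unique)
qed

lift_definition sum_over :: "'g set \<Rightarrow> 'g ell1 cdual" is "\<lambda>S a. \<Sum>\<^sub>\<infinity>x\<in>S. ell1_apply a x"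
proof (rule bounded_clinearI)
  fix S :: "'g set" and a b :: "'g ell1" and c
  have abs: "ell1_apply a abs_summable_on T" for T and a :: "'g ell1"
    using ell1_apply[of a] summable_on_subset_banach[of _ UNIV T] by auto
  show "(\<Sum>\<^sub>\<infinity>x\<in>S. ell1_apply (a + b) x) = (\<Sum>\<^sub>\<infinity>x\<in>S. ell1_apply a x) + (\<Sum>\<^sub>\<infinity>x\<in>S. ell1_apply b x)"
    by (simp add: plus_ell1.rep_eq infsum_add abs_summable_summable abs)
  show "(\<Sum>\<^sub>\<infinity>x\<in>S. ell1_apply (c *\<^sub>C a) x) = c * (\<Sum>\<^sub>\<infinity>x\<in>S. ell1_apply a x)"
    by (simp add: scaleC_ell1.rep_eq infsum_cmult_right')
  have "cmod (\<Sum>\<^sub>\<infinity>x\<in>S. ell1_apply a x) \<le> (\<Sum>\<^sub>\<infinity>x\<in>S. cmod (ell1_apply a x))"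
    by (rule norm_infsum_bound[OF abs])
  also have "\<dots> \<le> norm a"
    unfolding norm_ell1.rep_eq by (rule infsum_mono_neutral) (auto intro: abs)
  finally show "cmod (\<Sum>\<^sub>\<infinity>x\<in>S. ell1_apply a x) \<le> norm a * 1" by simp
qed

lemma sum_over_delta: "cdual_apply (sum_over S) (delta x) = of_bool (x \<in> S)"
proof -
  have "(\<Sum>\<^sub>\<infinity>y\<in>S. ell1_apply (delta x) y) = (\<Sum>\<^sub>\<infinity>y\<in>S \<inter> {x}. ell1_apply (delta x) y)"
    by (rule infsum_cong_neutral) (auto simp: delta.rep_eq)
  then show ?thesis by (cases "x \<in> S") (auto simp: sum_over.rep_eq delta.rep_eq)
qed

definition orthant :: "'i set \<Rightarrow> ('i \<Rightarrow>\<^sub>0 int) set" where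
  "orthant F = {x. \<forall>i\<in>F. 0 \<le> Poly_Mapping.lookup x i}"

lemma add_single_in_orthant:
  "x + Poly_Mapping.single i t \<in> orthant F \<longleftrightarrow>
    x \<in> orthant (F - {i}) \<and> (i \<in> F \<longrightarrow> 0 \<le> Poly_Mapping.lookup x i + t)"
  by (auto simp: orthant_def lookup_add lookup_single when_def)

abbreviation axis_difference :: "'i \<Rightarrow> nat \<Rightarrow> ('i \<Rightarrow>\<^sub>0 int) ell1" where
  "axis_difference i \<equiv>
    half_difference (delta (Poly_Mapping.single i 1)) (delta (Poly_Mapping.single i (- 1)))"

lemma delta_single_power:
  "delta (Poly_Mapping.single i t) ^ k = delta (Poly_Mapping.single i (int k * t))"
  by (induction k) (simp_all add: one_ell1_def delta_mult distrib_right flip: single_add)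

text \<open>On the line through \<open>x\<close> in direction \<open>i\<close>, the indicator function of the orthant is constant if
  \<open>i \<notin> F\<close>, and the two averages cancel. If \<open>i \<in> F\<close>, it is 0 far in the negative direction, and far
  in the positive direction it is 1 or 0 according to the constraints in the other directions.\<close>

lemma orthant_axis_difference_tendsto:
  "(\<lambda>n. cdual_apply (sum_over (orthant F)) (delta x * axis_difference i n))
    \<longlonglongrightarrow> of_bool (i \<in> F \<and> x \<in> orthant (F - {i}))"
proof -
  define h where "h t = (of_bool (x + Poly_Mapping.single i t \<in> orthant F) :: complex)" for t
  have lin: "linear (cdual_apply (sum_over (orthant F)))"
    by (rule bounded_linear.linear[OF bounded_linear_cdual_apply])
  have "cdual_apply (sum_over (orthant F)) (delta x * axis_difference i n)
      = inverse (real (Suc n)) *\<^sub>R (\<Sum>k\<le>n. h (int k) - h (- int (Suc k)))" for n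
    unfolding half_difference_def mult_scaleR_right sum_distrib_left right_diff_distrib
      delta_single_power delta_mult h_def
    by (simp add: linear_scale[OF lin] linear_sum[OF lin] linear_diff[OF lin] sum_over_delta
        del: of_nat_Suc)
  moreover have "h (int k) - h (- int (Suc k)) = of_bool (i \<in> F \<and> x \<in> orthant (F - {i}))"
    if "k \<ge> nat \<bar>Poly_Mapping.lookup x i\<bar>" for k
  proof -
    have "0 \<le> Poly_Mapping.lookup x i + int k" "\<not> 0 \<le> Poly_Mapping.lookup x i + - int (Suc k)"
      using that by linarith+
    then show ?thesis
      unfolding h_def add_single_in_orthant
      by (cases "i \<in> F"; cases "x \<in> orthant (F - {i})";
          simp only: simp_thms of_bool_eq diff_0_right diff_self)
  qed
  from average_tendsto[OF this]
  have "(\<lambda>n. inverse (real (Suc n)) *\<^sub>R (\<Sum>k\<le>n. h (int k) - h (- int (Suc k))))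
    \<longlonglongrightarrow> of_bool (i \<in> F \<and> x \<in> orthant (F - {i}))" .
  ultimately show ?thesis by presburger
qed

text \<open>The element \<open>\<Lambda>\<^sub>i\<close>: a weak-star limit of the differences of averages along the axis \<open>i\<close>. As
  functionals on the group algebra are determined on point masses, its action on orthants is the
  limit computed above.\<close>

lemma exists_axis_element:
  "\<exists>\<Lambda> :: ('i \<Rightarrow>\<^sub>0 int) ell1 bidual. norm \<Lambda> \<le> 2 \<and> (\<forall>w. \<Lambda> * w * \<Lambda> = 0) \<and>
    (\<forall>F. bidual_act (of_bidual \<Lambda>) (sum_over (orthant F))
      = (if i \<in> F then sum_over (orthant (F - {i})) else 0))"
proof -
  have one: "delta (Poly_Mapping.single i 1) * delta (Poly_Mapping.single i (- 1)) = 1"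
      "delta (Poly_Mapping.single i (- 1)) * delta (Poly_Mapping.single i (1::int)) = 1"
    by (simp_all add: delta_mult one_ell1_def flip: single_add)
  have bound: "norm (axis_difference i n) \<le> 2" for n
    by (rule norm_half_difference_le[OF one]) (simp_all add: norm_delta)
  have null: "(\<lambda>n. axis_difference i m * axis_difference i n) \<longlonglongrightarrow> 0" for m
    by (rule half_difference_mult_tendsto_0[OF one]) (simp_all add: norm_delta)
  obtain \<Lambda> U where \<Lambda>: "norm \<Lambda> \<le> 2" and U: "U \<noteq> bot" "U \<le> sequentially"
    and "\<forall>l. ((\<lambda>n. cdual_apply (canonical_embedding (axis_difference i n)) l)
      \<longlongrightarrow> cdual_apply \<Lambda> l) U"
    using exists_weak_star_limit[of "\<lambda>n. canonical_embedding (axis_difference i n)" 2]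
      order_trans[OF norm_canonical_embedding_le bound] by blast
  then have lim: "((\<lambda>n. cdual_apply l (axis_difference i n)) \<longlongrightarrow> cdual_apply \<Lambda> l) U" for l
    by (simp add: canonical_embedding.rep_eq)
  have act: "bidual_act \<Lambda> (sum_over (orthant F)) = (if i \<in> F then sum_over (orthant (F - {i})) else 0)" for F
  proof (rule ell1_functional_eqI)
    fix x
    have "((\<lambda>n. cdual_apply (sum_over (orthant F)) (delta x * axis_difference i n))
        \<longlongrightarrow> cdual_apply \<Lambda> (dual_act (sum_over (orthant F)) (delta x))) U"
      using lim[of "dual_act (sum_over (orthant F)) (delta x)"] by (simp add: dual_act.rep_eq)
    then have "cdual_apply \<Lambda> (dual_act (sum_over (orthant F)) (delta x))
        = of_bool (i \<in> F \<and> x \<in> orthant (F - {i}))"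
      by (rule tendsto_unique[OF U(1) _ tendsto_mono[OF U(2) orthant_axis_difference_tendsto]])
    then show "cdual_apply (bidual_act \<Lambda> (sum_over (orthant F))) (delta x)
        = cdual_apply (if i \<in> F then sum_over (orthant (F - {i})) else 0) (delta x)"
      by (simp add: bidual_act.rep_eq sum_over_delta zero_cdual.rep_eq)
  qed
  have sq: "arens (arens \<Lambda> \<Psi>) \<Lambda> = 0" for \<Psi>
    by (rule arens_sandwich_weak_star_limit_eq_0[OF ell1_mult_commute null U lim])
  have "Bidual \<Lambda> * w * Bidual \<Lambda> = 0" for w
    by (rule of_bidual_inject[THEN iffD1])
      (simp only: times_bidual.rep_eq zero_bidual.rep_eq Bidual_inverse[OF UNIV_I] sq)
  moreover have "of_bidual (Bidual \<Lambda>) = \<Lambda>" by (rule Bidual_inverse) simp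
  ultimately show ?thesis
    using \<Lambda> act by (intro exI[of _ "Bidual \<Lambda>"]) (simp only: norm_bidual.rep_eq simp_thms)
qed

section \<open>A radical element that is not nilpotent\<close>

lemma bounded_linear_bidual_apply: "bounded_linear (\<lambda>X. cdual_apply (of_bidual X) l)"
proof (rule bounded_linear_intro[of _ "norm l"])
  show "norm (cdual_apply (of_bidual X) l) \<le> norm X * norm l" for X
    by (simp add: norm_bidual.rep_eq norm_cdual_apply_le)
qed (simp_all add: plus_bidual.rep_eq plus_cdual.rep_eq scaleR_bidual.rep_eq scaleR_cdual.rep_eq)

text \<open>Peeling off the last factor of the power, every \<open>i \<in> F\<close> contributes \<open>c i\<close> times the value of the
  remaining power on the orthant of \<open>F - {i}\<close>, and the other indices contribute 0.\<close>

lemma power_on_orthant: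
  fixes \<Lambda> :: "nat \<Rightarrow> (nat \<Rightarrow>\<^sub>0 int) ell1 bidual" and c :: "nat \<Rightarrow> real"
  assumes sum: "summable (\<lambda>i. c i *\<^sub>R \<Lambda> i)"
    and act: "\<And>i F. bidual_act (of_bidual (\<Lambda> i)) (sum_over (orthant F))
      = (if i \<in> F then sum_over (orthant (F - {i})) else 0)"
    and F: "finite F"
  shows "cdual_apply (of_bidual ((suminf (\<lambda>i. c i *\<^sub>R \<Lambda> i)) ^ card F)) (sum_over (orthant F))
    = of_real (fact (card F) * (\<Prod>i\<in>F. c i))"
  using F
proof (induction "card F" arbitrary: F)
  case 0
  then show ?case
    by (simp add: one_bidual.rep_eq canonical_embedding.rep_eq one_ell1_def sum_over_delta orthant_def)
next
  case (Suc n)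
  let ?T = "suminf (\<lambda>i. c i *\<^sub>R \<Lambda> i)" and ?S = "\<lambda>F. sum_over (orthant F) :: (nat \<Rightarrow>\<^sub>0 int) ell1 cdual"
  have bl: "bounded_linear (\<lambda>Y. cdual_apply (of_bidual (?T ^ n * Y)) (?S F))"
    by (rule bounded_linear_compose[OF bounded_linear_bidual_apply bounded_linear_mult_right])
  have IH: "cdual_apply (of_bidual (?T ^ n)) (?S (F - {i})) = of_real (fact n * (\<Prod>j\<in>F - {i}. c j))"
    if "i \<in> F" for i
  proof -
    have n: "n = card (F - {i})" using Suc.hyps(2) that by simp
    show ?thesis using Suc.hyps(1)[OF n] Suc.prems unfolding n[symmetric] by blast
  qed
  have summand: "cdual_apply (of_bidual (?T ^ n * (c i *\<^sub>R \<Lambda> i))) (?S F)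
      = (if i \<in> F then of_real (fact n * (\<Prod>j\<in>F. c j)) else 0)" for i
    using IH[of i] prod.remove[OF Suc.prems, of i c]
    by (auto simp: times_bidual.rep_eq scaleR_bidual.rep_eq scaleR_cdual.rep_eq arens.rep_eq act
        cdual_apply_zero_right scaleR_conv_of_real)
  have "cdual_apply (of_bidual (?T ^ n * ?T)) (?S F)
      = suminf (\<lambda>i. cdual_apply (of_bidual (?T ^ n * (c i *\<^sub>R \<Lambda> i))) (?S F))"
    by (rule bounded_linear.suminf[OF bl sum])
  also have "\<dots> = (\<Sum>i\<in>F. of_real (fact n * (\<Prod>j\<in>F. c j)))"
    unfolding summand by (rule sums_unique[symmetric, OF sums_If_finite_set[OF Suc.prems]])
  also have "\<dots> = of_real (fact (Suc n) * (\<Prod>i\<in>F. c i))"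
    by (simp flip: Suc.hyps(2) add: algebra_simps)
  finally show ?case by (simp only: flip: Suc.hyps(2) power_Suc2)
qed

theorem corollary4p6:
  shows "\<exists>\<Phi> :: (nat \<Rightarrow>\<^sub>0 int) ell1 bidual. \<Phi> \<in> jacobson_radical \<and> \<not> nilpotent \<Phi>"
proof -
  obtain \<Lambda> :: "nat \<Rightarrow> (nat \<Rightarrow>\<^sub>0 int) ell1 bidual" where
    bound: "\<And>i. norm (\<Lambda> i) \<le> 2" and sq: "\<And>i w. \<Lambda> i * w * \<Lambda> i = 0" and
    act: "\<And>i F. bidual_act (of_bidual (\<Lambda> i)) (sum_over (orthant F))
      = (if i \<in> F then sum_over (orthant (F - {i})) else 0)"
    using exists_axis_element by metis
  \<comment> \<open>Any nonzero absolutely summable weights would do.\<close>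
  define c where "c i = (1 / 2 :: real) ^ i" for i :: nat
  have "summable (\<lambda>i. norm (c i *\<^sub>R \<Lambda> i))"
  proof (rule summable_comparison_test')
    show "summable (\<lambda>i. (1 / 2 :: real) ^ i * 2)" by (intro summable_mult2 summable_geometric) simp
    show "norm (norm (c i *\<^sub>R \<Lambda> i)) \<le> (1 / 2) ^ i * 2" for i
      using bound[of i] by (simp add: c_def)
  qed
  then have sum: "summable (\<lambda>i. c i *\<^sub>R \<Lambda> i)" by (rule summable_norm_cancel)
  let ?T = "suminf (\<lambda>i. c i *\<^sub>R \<Lambda> i)"
  have "?T \<in> jacobson_radical"
    by (rule suminf_in_jacobson_radical[OF sum]) (simp add: sq)
  moreover have "?T ^ n \<noteq> 0" for n
  proof
    assume "?T ^ n = 0"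
    then have "cdual_apply (of_bidual (?T ^ card {..<n})) (sum_over (orthant {..<n})) = 0"
      by (simp add: zero_bidual.rep_eq zero_cdual.rep_eq)
    then show False
      unfolding power_on_orthant[OF sum act finite_lessThan] by (simp add: c_def)
  qed
  ultimately show ?thesis unfolding nilpotent_def by blast
qed

end
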